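(* Let $n,m\geq 1$ be integers. Let $M$ be an $nm\times nm$ matrix over $\mathbb{F}_2$, with rows and columns indexed by pairs $(i,j)$, $1\le i\le n$, $1\le j\le m$ (the vertices of the $n\times m$ grid), and assume that $M$ commutes with $A:=J_n\otimes I_m$ and $B:=I_n\otimes J_m$. Then there is a polynomial $U\in\mathbb{F}_2[X,Y]$ with $M=U(A,B)$; fix any such $U$. Assume the following condition: for all $\alpha,\beta\in\overline{\mathbb{F}}_2$ with $Q_n(\alpha)=0$, $Q_m(\beta)=0$ and $U(\alpha,\beta)=0$, if $\alpha$ is a root of multiplicity $\geq 2$ of $Q_n$ then $\frac{\partial U}{\partial X}(\alpha,\beta)\neq 0$, and if $\beta$ is a root of multiplicity $\ge 2$ of $Q_m$ then $\frac{\partial U}{\partial Y}(\alpha,\beta)\neq 0$. Then every doubly symmetric configuration $y\in\mathbb{F}_2^{n\times m}$ lies in the image of $M$ (i.e. can be achieved from the all-off configuration) if and only if the following three conditions do not simultaneously hold: $n$ and $m$ are both odd; $U(0,0)=0$; $v_2(n+1)=v_2(m+1)$.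
   Context: For $n\ge1$, $J_n$ is the $n\times n$ matrix over $\mathbb{F}_2$ with $1$'s directly above and below the diagonal and $0$'s elsewhere. The polynomials $Q_n\in\mathbb{F}_2[X]$ are defined by $Q_0=1$, $Q_1=X$, $Q_{n+1}=XQ_n+Q_{n-1}$ (so $Q_n$ is the characteristic polynomial of $J_n$; equivalently $Q_n$ is the reduction mod 2 of $P_{n+1}/X$, where $P_0=2$, $P_1=X$, $P_{n+1}=XP_n+P_{n-1}$ in $\mathbb{Z}[X]$). A configuration is a vector $y=(y_{i,j})\in\mathbb{F}_2^{n\times m}=\mathbb{F}_2^{nm}$ (entry $1$ meaning the vertex is lit); pushing vertex $(i,j)$ adds column $(i,j)$ of $M$, so a configuration is achievable from the all-off configuration iff it is in the image of $M$. A configuration is doubly symmetric if $y_{i,j}=y_{n+1-i,j}=y_{i,m+1-j}=y_{n+1-i,m+1-j}$ for all $i,j$. $v_2(N)$ denotes the largest $j$ with $2^j\mid N$. $\overline{\mathbb{F}}_2$ is an algebraic closure of $\mathbb{F}_2$. *)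

theory Defs
  imports
    "Jordan_Normal_Form.Matrix"
    "HOL-Algebra.Algebraic_Closure_Type"
    "HOL-Library.Z2"
begin

text \<open>
  The field with two elements is the type \<^typ>\<open>bit\<close>; its algebraic closure is
  \<^typ>\<open>bit alg_closure\<close>, with embedding \<^const>\<open>to_ac\<close>.
\<close>

definition J_mat :: "nat \<Rightarrow> bit mat" where
  "J_mat n = mat n n (\<lambda>(i, j). if i = Suc j \<or> j = Suc i then 1 else 0)"

fun Q_poly :: "nat \<Rightarrow> bit poly" where
  "Q_poly 0 = 1"
| "Q_poly (Suc 0) = [:0, 1:]"
| "Q_poly (Suc (Suc n)) = [:0, 1:] * Q_poly (Suc n) + Q_poly n"

text \<open>
  Matrices with rows and columns indexed by the vertices of the \<open>n \<times> m\<close> grid are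
  \<open>n * m \<times> n * m\<close> matrices, the vertex \<open>(i, j)\<close> (with \<open>i < n\<close>, \<open>j < m\<close>, counted from 0)
  having index \<open>i * m + j\<close>. The Kronecker product and \<open>vec_of_config\<close> both follow
  this row-major order.
\<close>

definition kronecker :: "'a::times mat \<Rightarrow> 'a mat \<Rightarrow> 'a mat" where
  "kronecker A B = mat (dim_row A * dim_row B) (dim_col A * dim_col B)
     (\<lambda>(r, c). A $$ (r div dim_row B, c div dim_col B) * B $$ (r mod dim_row B, c mod dim_col B))"

definition vec_of_config :: "'a mat \<Rightarrow> 'a vec" where
  "vec_of_config y =
     vec (dim_row y * dim_col y) (\<lambda>k. y $$ (k div dim_col y, k mod dim_col y))"

text \<open>
  Since indices start at 0, the reflections are \<open>i \<mapsto> n - 1 - i\<close> and \<open>j \<mapsto> m - 1 - j\<close>.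
\<close>

definition doubly_symmetric :: "nat \<Rightarrow> nat \<Rightarrow> 'a mat \<Rightarrow> bool" where
  "doubly_symmetric n m y \<longleftrightarrow> (\<forall>i<n. \<forall>j<m.
     y $$ (i, j) = y $$ (n - 1 - i, j) \<and>
     y $$ (i, j) = y $$ (i, m - 1 - j) \<and>
     y $$ (i, j) = y $$ (n - 1 - i, m - 1 - j))"

definition mat_image :: "'a::semiring_0 mat \<Rightarrow> 'a vec set" where
  "mat_image M = (\<lambda>x. M *\<^sub>v x) ` carrier_vec (dim_col M)"

text \<open>
  A polynomial \<open>U \<in> K[X, Y]\<close> is an element of \<open>K[X][Y]\<close>: the coefficient of \<open>X^i * Y^j\<close>
  is \<open>coeff (coeff U j) i\<close>.
\<close>

definition eval2 :: "'a::comm_semiring_0 poly poly \<Rightarrow> 'a \<Rightarrow> 'a \<Rightarrow> 'a" where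
  "eval2 U x y = poly (poly U [:y:]) x"

definition deriv_X :: "'a::{comm_semiring_1, semiring_no_zero_divisors} poly poly \<Rightarrow> 'a poly poly" where
  "deriv_X U = map_poly pderiv U"

definition deriv_Y :: "'a::{comm_semiring_1, semiring_no_zero_divisors} poly poly \<Rightarrow> 'a poly poly" where
  "deriv_Y U = pderiv U"

definition eval2_ac :: "'a::field poly poly \<Rightarrow> 'a alg_closure \<Rightarrow> 'a alg_closure \<Rightarrow> 'a alg_closure" where
  "eval2_ac U \<alpha> \<beta> = eval2 (map_poly (map_poly to_ac) U) \<alpha> \<beta>"

text \<open>
  The value \<open>U(A, B)\<close> at square matrices of the same size. The finite sum of matrices is
  written entrywise, because \<^typ>\<open>'a mat\<close> is not an additive monoid as a type.
\<close>

definition eval2_mat :: "'a::semiring_1 poly poly \<Rightarrow> 'a mat \<Rightarrow> 'a mat \<Rightarrow> 'a mat" where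
  "eval2_mat U A B = mat (dim_row A) (dim_row A) (\<lambda>(r, c).
     \<Sum>j\<le>degree U. \<Sum>i\<le>degree (coeff U j).
       coeff (coeff U j) i * (A ^\<^sub>m i * B ^\<^sub>m j) $$ (r, c))"

definition roots_condition :: "nat \<Rightarrow> nat \<Rightarrow> bit poly poly \<Rightarrow> bool" where
  "roots_condition n m U \<longleftrightarrow> (\<forall>\<alpha> \<beta> :: bit alg_closure.
     poly (map_poly to_ac (Q_poly n)) \<alpha> = 0 \<and>
     poly (map_poly to_ac (Q_poly m)) \<beta> = 0 \<and>
     eval2_ac U \<alpha> \<beta> = 0 \<longrightarrow>
       (Polynomial.order \<alpha> (map_poly to_ac (Q_poly n)) \<ge> 2 \<longrightarrow> eval2_ac (deriv_X U) \<alpha> \<beta> \<noteq> 0) \<and>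
       (Polynomial.order \<beta> (map_poly to_ac (Q_poly m)) \<ge> 2 \<longrightarrow> eval2_ac (deriv_Y U) \<alpha> \<beta> \<noteq> 0))"

end

theory Submission
  imports Defs "Jordan_Normal_Form.Char_Poly"
begin

text \<open>
  Identify the configuration \<open>y\<close> with the class of \<open>\<Sum> y\<^sub>i\<^sub>j Q\<^sub>i(X) Q\<^sub>j(Y)\<close> modulo
  \<open>(Q\<^sub>n(X), Q\<^sub>m(Y))\<close>: then \<open>A\<close> and \<open>B\<close> become multiplication by \<open>X\<close> and \<open>Y\<close>, the image of \<open>M\<close>
  is the ideal generated by \<open>U\<close>, and, as \<open>Q\<^sub>n = S\<^sub>n\<^sup>2\<close> (\<open>n\<close> even) or \<open>Q\<^sub>n = X S\<^sub>n\<^sup>2\<close> (\<open>n\<close> odd), the doubly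
  symmetric configurations form the ideal generated by \<open>S\<^sub>n(X) S\<^sub>m(Y)\<close>. So the question is whether
  \<open>S\<^sub>n(X) S\<^sub>m(Y) \<in> (U, Q\<^sub>n(X), Q\<^sub>m(Y))\<close>, which is tested locally over the algebraic closure. Let
  \<open>(\<alpha>, \<beta>)\<close> be a common zero, of multiplicities \<open>a, b\<close> in \<open>Q\<^sub>n, Q\<^sub>m\<close> and \<open>s, t\<close> in \<open>S\<^sub>n, S\<^sub>m\<close>. The condition
  on the derivatives makes \<open>X - \<alpha>\<close> and \<open>Y - \<beta>\<close> associated modulo \<open>U\<close>, so membership amounts to
  \<open>min a b \<le> s + t\<close>. As \<open>a \<in> {2 s, 2 s + 1}\<close> and \<open>b \<in> {2 t, 2 t + 1}\<close>, this fails only if \<open>s = t\<close> and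
  both \<open>a\<close> and \<open>b\<close> are odd, that is, at the origin with \<open>n\<close>, \<open>m\<close> odd and \<open>v\<^sub>2(n + 1) = v\<^sub>2(m + 1)\<close>.
\<close>

section \<open>The polynomials \<open>Q\<^sub>n\<close> in characteristic 2\<close>

text \<open>The recurrence is run at an element of an arbitrary commutative ring, so that the same
  lemmas serve Q_n(X) and Q_n(Y) inside K[X][Y].\<close>

fun Q_seq :: "'a::comm_ring_1 \<Rightarrow> nat \<Rightarrow> 'a" where
  "Q_seq x 0 = 1"
| "Q_seq x (Suc 0) = x"
| "Q_seq x (Suc (Suc n)) = x * Q_seq x (Suc n) + Q_seq x n"

text \<open>This is the S_n of the overview. At \<open>n = 0\<close> truncated subtraction yields
  \<open>1 + 1\<close>, so the factorisation of Q_n is stated for \<open>n > 0\<close>.\<close>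

definition half_Q :: "'a::comm_ring_1 \<Rightarrow> nat \<Rightarrow> 'a" where
  "half_Q x n = (if odd n then Q_seq x (n div 2) else Q_seq x (n div 2) + Q_seq x (n div 2 - 1))"

lemma Q_poly_eq_Q_seq: "Q_poly n = Q_seq [:0, 1:] n"
  by (induction n rule: Q_poly.induct) auto

lemma (in comm_ring_hom) hom_Q_seq: "hom (Q_seq x n) = Q_seq (hom x) n"
  by (induction n rule: Q_poly.induct) (auto simp: hom_distribs)

lemma (in comm_ring_hom) hom_half_Q: "hom (half_Q x n) = half_Q (hom x) n"
  by (simp add: half_Q_def hom_Q_seq hom_distribs)

text \<open>The addition formula for continuants: both sides obey the same recurrence in
  \<open>a\<close>. Splitting an index into two nearly equal halves will expose the square.\<close>

lemma Q_seq_add: "Q_seq x (Suc a + Suc b) = Q_seq x (Suc a) * Q_seq x (Suc b) + Q_seq x a * Q_seq x b"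
proof (induction a rule: Q_poly.induct)
  case (3 n)
  have "Q_seq x (Suc (Suc (Suc n)) + Suc b)
      = x * Q_seq x (Suc (Suc n) + Suc b) + Q_seq x (Suc n + Suc b)"
    by simp
  then show ?case
    unfolding 3 by (simp add: algebra_simps)
qed (auto simp: algebra_simps)

section \<open>Characteristic 2: square roots and reflection symmetry\<close>

context
  fixes x :: "'a::comm_ring_1"
  assumes char2: "(2::'a) = 0"
begin

lemma add_self_char2: "a + a = (0::'a)"
  using char2 by (metis mult_2 mult_zero_left)

lemma add_self_left_char2: "a + (a + b) = (b::'a)"
  by (simp add: add_self_char2 flip: add.assoc)

text \<open>Apply the addition formula to k + k or (k + 1) + k. For even n, Q_k^2 + Q_(k-1)^2 is a
  square by Frobenius. For odd n, Q_n = Q_k (Q_(k+1) + Q_(k-1)), and the recurrence turns the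
  bracket into x Q_k.\<close>

lemma Q_seq_eq_half_Q:
  assumes "n > 0"
  shows "Q_seq x n = (if odd n then x else 1) * (half_Q x n)\<^sup>2"
proof (cases "odd n")
  case True
  then obtain k where k: "n = 2 * k + 1" by (elim oddE)
  show ?thesis
  proof (cases k)
    case 0
    then show ?thesis by (simp add: k half_Q_def)
  next
    case (Suc l)
    have "Q_seq x n = Q_seq x (Suc (Suc l) + Suc l)"
      by (simp add: k Suc mult_2)
    also have "\<dots> = x * (Q_seq x k)\<^sup>2 + (Q_seq x l * Q_seq x k + Q_seq x l * Q_seq x k)"
      by (simp only: Q_seq_add) (simp add: Suc algebra_simps power2_eq_square)
    finally show ?thesis
      using True by (simp add: k half_Q_def add_self_char2)
  qed
next
  case False
  then obtain k where k: "n = 2 * k" by (auto elim: evenE)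
  with assms obtain l where l: "k = Suc l" by (cases k) auto
  have "Q_seq x n = Q_seq x (Suc l + Suc l)"
    by (simp add: k l mult_2)
  also have "\<dots> = (Q_seq x k + Q_seq x l)\<^sup>2 - (Q_seq x k * Q_seq x l + Q_seq x k * Q_seq x l)"
    by (simp only: Q_seq_add) (simp add: l algebra_simps power2_eq_square)
  finally show ?thesis
    using False by (simp add: k l half_Q_def add_self_char2)
qed

text \<open>In characteristic 2 the recurrence reads the same in both directions; this is the source
  of the reflection symmetry below.\<close>

lemma Q_seq_backwards: "Q_seq x n = x * Q_seq x (Suc n) + Q_seq x (Suc (Suc n))"
  by (simp add: add_self_left_char2)

text \<open>As functions of d, the reflected sums satisfy the recurrence of the Q_d again, because
  it also runs backwards. So divisibility propagates from the first two: d = 0 is the divisor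
  itself, d = 1 is x + 1 times it.\<close>

lemma half_Q_dvd_even:
  assumes "d < k"
  shows "Q_seq x k + Q_seq x (k - 1) dvd Q_seq x (k + d) + Q_seq x (k - Suc d)"
  using assms
proof (induction d rule: Q_poly.induct)
  case 2
  then obtain l where k: "k = Suc (Suc l)"
    by (metis Suc_diff_Suc add_0 less_iff_Suc_add plus_1_eq_Suc Suc_lessE)
  have "Q_seq x (k + 1) + Q_seq x l
      = (x + 1) * (Q_seq x k + Q_seq x (Suc l))"
    unfolding Q_seq_backwards[of l] by (simp add: k algebra_simps add_self_left_char2 add_self_char2)
  then show ?case by (simp add: k)
next
  case (3 d)
  define j where "j = k - Suc (Suc (Suc d))"
  have j: "k - Suc (Suc d) = Suc j" "k - Suc d = Suc (Suc j)"
    using 3 by (auto simp: j_def)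
  have "Q_seq x (k + Suc (Suc d)) + Q_seq x j
    = x * (Q_seq x (k + Suc d) + Q_seq x (Suc j)) + (Q_seq x (k + d) + Q_seq x (Suc (Suc j)))"
    unfolding Q_seq_backwards[of j] by (simp add: algebra_simps)
  then show ?case
    using 3 unfolding j j_def[symmetric] by (simp del: Q_seq.simps)
qed auto

text \<open>The same argument with the reflection centred at Q_k: the first two sums are x Q_k and
  x^2 Q_k.\<close>

lemma half_Q_dvd_odd:
  assumes "d < k"
  shows "Q_seq x k dvd Q_seq x (k + Suc d) + Q_seq x (k - Suc d)"
  using assms
proof (induction d rule: Q_poly.induct)
  case 1
  then obtain l where k: "k = Suc l"
    by (cases k) auto
  show ?case by (simp add: k add.assoc add_self_char2)
next
  case 2
  then obtain l where k: "k = Suc (Suc l)"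
    by (metis Suc_diff_Suc add_0 less_iff_Suc_add plus_1_eq_Suc Suc_lessE)
  have "Q_seq x (k + 2) + Q_seq x l = (x * x) * Q_seq x k"
    unfolding Q_seq_backwards[of l]
    by (simp add: k algebra_simps add_self_left_char2 add_self_char2)
  then show ?case by (simp add: k)
next
  case (3 d)
  define j where "j = k - Suc (Suc (Suc d))"
  have j: "k - Suc (Suc d) = Suc j" "k - Suc d = Suc (Suc j)"
    using 3 by (auto simp: j_def)
  have "Q_seq x (k + Suc (Suc (Suc d))) + Q_seq x j
    = x * (Q_seq x (k + Suc (Suc d)) + Q_seq x (Suc j)) + (Q_seq x (k + Suc d) + Q_seq x (Suc (Suc j)))"
    unfolding Q_seq_backwards[of j] by (simp add: algebra_simps)
  then show ?case
    using 3 unfolding j j_def[symmetric] by (simp del: Q_seq.simps)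
qed

text \<open>Pair i with n - 1 - i. The equal coefficients factor out and leave the reflected sums
  just treated; for odd n the unpaired middle term is a multiple of Q_k = S_n.\<close>

lemma half_Q_dvd_symmetric_sum:
  assumes sym: "\<And>i. i < n \<Longrightarrow> c i = c (n - 1 - i)"
  shows "half_Q x n dvd (\<Sum>i<n. c i * Q_seq x i)"
proof (cases "odd n")
  case True
  then obtain k where k: "n = 2 * k + 1" by (elim oddE)
  define f where "f i = c i * Q_seq x i" for i
  have "(\<Sum>i<n. f i) = (\<Sum>i<k. f i) + (\<Sum>i=k..<n. f i)"
    by (simp add: k lessThan_atLeast0 sum.atLeastLessThan_concat)
  also have "(\<Sum>i=k..<n. f i) = f k + (\<Sum>i=Suc k..<n. f i)"
    by (rule sum.atLeast_Suc_lessThan) (simp add: k)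
  also have "(\<Sum>i=Suc k..<n. f i) = (\<Sum>d<k. f (k + Suc d))"
    by (rule sum.reindex_bij_witness[where i = "\<lambda>d. k + Suc d" and j = "\<lambda>i. i - Suc k"])
       (auto simp: k)
  also have "(\<Sum>i<k. f i) = (\<Sum>d<k. f (k - Suc d))"
    by (rule sum.nat_diff_reindex[symmetric])
  finally have "(\<Sum>i<n. f i) = f k + (\<Sum>d<k. f (k + Suc d) + f (k - Suc d))"
    by (simp add: sum.distrib algebra_simps)
  also have "(\<Sum>d<k. f (k + Suc d) + f (k - Suc d))
      = (\<Sum>d<k. c (k + Suc d) * (Q_seq x (k + Suc d) + Q_seq x (k - Suc d)))"
  proof (rule sum.cong)
    fix d assume "d \<in> {..<k}"
    then have "c (k + Suc d) = c (k - Suc d)"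
      using sym[of "k + Suc d"] by (simp add: k)
    then show "f (k + Suc d) + f (k - Suc d)
        = c (k + Suc d) * (Q_seq x (k + Suc d) + Q_seq x (k - Suc d))"
      by (simp add: f_def algebra_simps)
  qed auto
  finally show ?thesis
    using True half_Q_dvd_odd
    by (auto simp: k half_Q_def f_def simp del: Q_seq.simps add_Suc_right intro!: dvd_add dvd_sum)
next
  case False
  then obtain k where k: "n = 2 * k" by (auto elim: evenE)
  define f where "f i = c i * Q_seq x i" for i
  have "(\<Sum>i<n. f i) = (\<Sum>i<k. f i) + (\<Sum>i=k..<n. f i)"
    by (simp add: k lessThan_atLeast0 sum.atLeastLessThan_concat)
  also have "(\<Sum>i=k..<n. f i) = (\<Sum>d<k. f (k + d))"
    by (rule sum.reindex_bij_witness[where i = "\<lambda>d. k + d" and j = "\<lambda>i. i - k"])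
       (auto simp: k)
  also have "(\<Sum>i<k. f i) = (\<Sum>d<k. f (k - Suc d))"
    by (rule sum.nat_diff_reindex[symmetric])
  finally have "(\<Sum>i<n. f i) = (\<Sum>d<k. f (k + d) + f (k - Suc d))"
    by (simp add: sum.distrib algebra_simps)
  also have "\<dots> = (\<Sum>d<k. c (k + d) * (Q_seq x (k + d) + Q_seq x (k - Suc d)))"
  proof (rule sum.cong)
    fix d assume "d \<in> {..<k}"
    then have "c (k + d) = c (k - Suc d)"
      using sym[of "k + d"] by (simp add: k)
    then show "f (k + d) + f (k - Suc d) = c (k + d) * (Q_seq x (k + d) + Q_seq x (k - Suc d))"
      by (simp add: f_def algebra_simps)
  qed auto
  finally show ?thesis
    using False half_Q_dvd_even
    by (auto simp: k half_Q_def f_def simp del: Q_seq.simps intro!: dvd_sum)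
qed

end

section \<open>Degrees, and the order of Q_n at 0\<close>

lemma monic_Q_seq_X:
  "degree (Q_seq [:0, 1::'a::idom:] n) = n \<and> lead_coeff (Q_seq [:0, 1::'a:] n) = 1"
proof (induction n rule: Q_poly.induct)
  case (3 n)
  have *: "degree ([:0, 1:] * Q_seq [:0, 1::'a:] (Suc n)) = Suc (Suc n)"
    using 3 by (subst degree_mult_eq) auto
  have "degree (Q_seq [:0, 1::'a:] (Suc (Suc n))) = Suc (Suc n)"
    using 3 * by (simp only: Q_seq.simps) (subst degree_add_eq_left, auto)
  moreover have "coeff (Q_seq [:0, 1::'a:] (Suc n)) (Suc n) = 1"
    using 3 by metis
  ultimately show ?case
    using 3 by (simp add: coeff_eq_0)
qed auto

lemmas degree_Q_seq_X = monic_Q_seq_X[THEN conjunct1]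
  and lead_coeff_Q_seq_X = monic_Q_seq_X[THEN conjunct2]

lemma Q_seq_X_nonzero: "Q_seq [:0, 1::'a::idom:] n \<noteq> 0"
  using lead_coeff_Q_seq_X[of n, where 'a='a] by force

text \<open>For n = 2 k + 1, Q_n = X Q_k^2 gives ord Q_n + 1 = 2 (ord Q_k + 1), in step with n + 1 =
  2 (k + 1). For even n, Q_n(0) = 1.\<close>

lemma order_0_Q_seq_X:
  assumes char2: "(2::'a::field) = 0"
  shows "Polynomial.order 0 (Q_seq [:0, 1::'a:] n) + 1 = 2 ^ multiplicity 2 (n + 1)"
proof (induction n rule: less_induct)
  case (less n)
  have c: "(2::'a poly) = 0"
    using char2 by (metis of_nat_numeral of_nat_poly pCons_0_0)
  show ?case
  proof (cases "odd n")
    case True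
    then obtain k where k: "n = 2 * k + 1" by (elim oddE)
    have nz: "Q_seq [:0, 1::'a:] k \<noteq> 0" by (rule Q_seq_X_nonzero)
    have "Q_seq [:0, 1::'a:] n = [:0, 1:] * (Q_seq [:0, 1:] k * Q_seq [:0, 1:] k)"
      using Q_seq_eq_half_Q[OF c, of n "[:0, 1:]"] True
      by (simp add: k half_Q_def power2_eq_square)
    then have "Polynomial.order 0 (Q_seq [:0, 1::'a:] n) = 1 + 2 * Polynomial.order 0 (Q_seq [:0, 1::'a:] k)"
      using nz order_power_n_n[of "0::'a" 1] by (simp add: order_mult del: mult_pCons_left)
    moreover have "multiplicity 2 (2 * (k + 1)) = Suc (multiplicity 2 (k + 1))"
      by (rule multiplicity_times_same) auto
    ultimately show ?thesis
      using less[of k] by (simp add: k)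
  next
    case False
    have "poly (Q_seq [:0, 1::'a:] n) 0 = Q_seq (poly [:0, 1:] 0) n"
      by (rule poly_hom.hom_Q_seq)
    also have "\<dots> = 1"
      using False unfolding poly_pCons by (induction n rule: Q_poly.induct) auto
    finally have "Polynomial.order 0 (Q_seq [:0, 1::'a:] n) = 0"
      by (intro order_0I) auto
    then show ?thesis
      using False by (simp add: not_dvd_imp_multiplicity_0)
  qed
qed

section \<open>Ideals of bivariate polynomials\<close>

text \<open>The ring is a module over itself: its subspaces are the ideals, and
  \<open>ideal.span\<close> is the ideal generated by a set.\<close>

interpretation ideal: Modules.module "(*) :: 'a::comm_ring_1 \<Rightarrow> 'a \<Rightarrow> 'a"
  by unfold_locales (simp_all add: algebra_simps)

interpretation const_poly: inj_comm_ring_hom "\<lambda>c :: 'a::comm_ring_1. [:c:]"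
  by unfold_locales simp_all

text \<open>The outer variable is Y, so \<open>[:p:]\<close> stands for p(X) and
  \<open>in_Y p\<close> for p(Y).\<close>

abbreviation in_Y :: "'a::comm_ring_1 poly \<Rightarrow> 'a poly poly" where
  "in_Y \<equiv> map_poly (\<lambda>c. [:c:])"

interpretation poly_in_Y: map_poly_inj_comm_ring_hom "\<lambda>c :: 'a::comm_ring_1. [:c:]" ..

lemma poly_poly_in_Y [simp]: "poly (in_Y p) [:y:] = [:poly p y:]"
  by (induction p) (simp_all add: map_poly_pCons mult.commute)

lemma poly_in_Y_X: "in_Y [:0, 1 :: 'a::comm_ring_1:] = [:0, 1:]"
  by (simp add: map_poly_pCons)

text \<open>Divide by Y - b, then the remainder f(X, b) by X - a. The cofactors take the values of
  the partial derivatives at (a, b), so a nonvanishing derivative makes the corresponding cofactor a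
  local unit.\<close>

lemma bivariate_taylor:
  fixes f :: "'a::idom poly poly"
  obtains u v where
    "f = [:[:eval2 f a b:]:] + [:[:-a, 1:]:] * u + [:[:-b:], 1:] * v"
    "eval2 u a b = eval2 (deriv_X f) a b"
    "eval2 v a b = eval2 (deriv_Y f) a b"
proof -
  let ?p = "poly f [:b:]"
  have "poly (f - [:?p:]) [:b:] = 0" by simp
  then obtain v where v: "f - [:?p:] = [:-[:b:], 1:] * v"
    unfolding poly_eq_0_iff_dvd by (elim dvdE)
  have "poly (?p - [:poly ?p a:]) a = 0" by simp
  then obtain w where w: "?p - [:poly ?p a:] = [:-a, 1:] * w"
    unfolding poly_eq_0_iff_dvd by (elim dvdE)
  have f: "f = [:?p:] + [:-[:b:], 1:] * v"
    using v by (simp add: algebra_simps)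
  have p: "?p = [:poly ?p a:] + [:-a, 1:] * w"
    using w by (simp add: algebra_simps)
  have "poly (pderiv f) [:b:] = poly v [:b:]"
    by (subst f, subst pderiv_add, subst pderiv_mult) (simp add: pderiv_pCons)
  then have dY: "eval2 v a b = eval2 (deriv_Y f) a b"
    by (simp add: eval2_def deriv_Y_def)
  have "poly (map_poly pderiv f) [:b:] = pderiv ?p"
    by (induction f) (simp_all add: map_poly_pCons pderiv_add pderiv_mult pderiv_smult pderiv_pCons)
  also have "poly (pderiv ?p) a = poly w a"
    by (subst p, subst pderiv_add, subst pderiv_mult) (simp add: pderiv_pCons)
  finally have dX: "eval2 [:w:] a b = eval2 (deriv_X f) a b"
    by (simp add: eval2_def deriv_X_def)
  have "f = [:[:poly ?p a:] + [:-a, 1:] * w:] + [:-[:b:], 1:] * v"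
    using f p by simp
  also have "[:[:poly ?p a:] + [:-a, 1:] * w:] = [:[:poly ?p a:]:] + [:[:-a, 1:]:] * [:w:]"
    by simp
  finally have "f = [:[:eval2 f a b:]:] + [:[:-a, 1:]:] * [:w:] + [:[:-b:], 1:] * v"
    by (simp add: eval2_def)
  then show thesis
    using that dX dY by blast
qed

text \<open>Split linear factors off p until the cofactor no longer sends w into C; this must
  happen, since a nonzero constant would put w itself in C. Leaving \<open>e\<close> abstract covers
  both X, through \<open>[:p:]\<close>, and Y, through \<open>in_Y\<close>.\<close>

lemma ex_linear_factor_annihilator:
  fixes p :: "'k::alg_closed_field poly" and e :: "'k poly \<Rightarrow> 'r::comm_ring_1"
  assumes hom: "comm_ring_hom e" and C: "ideal.subspace C"
    and p: "p \<noteq> 0" "e p * w \<in> C" and w: "w \<notin> C"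
  obtains a q where "e q * w \<notin> C" "e [:-a, 1:] * (e q * w) \<in> C"
proof -
  interpret comm_ring_hom e by fact
  have "\<exists>a q. e q * w \<notin> C \<and> e [:-a, 1:] * (e q * w) \<in> C"
    using p
  proof (induction "degree p" arbitrary: p)
    case 0
    obtain c where c: "p = [:c:]"
      using degree_eq_zeroE 0(1) by metis
    with 0(2) have "c \<noteq> 0" by simp
    have "e [:inverse c:] * (e p * w) = e ([:inverse c:] * p) * w"
      by (simp only: hom_mult mult.assoc)
    also have "[:inverse c:] * p = 1"
      using \<open>c \<noteq> 0\<close> by (simp add: c)
    finally have w': "e [:inverse c:] * (e p * w) = w" by simp
    have "e [:inverse c:] * (e p * w) \<in> C"
      by (rule ideal.subspace_scale[OF C 0(3)])
    then show ?case using w w' by simp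
  next
    case (Suc d)
    then obtain a where "poly p a = 0"
      by (metis alg_closed_imp_poly_has_root zero_less_Suc)
    then obtain q where q: "p = [:-a, 1:] * q"
      unfolding poly_eq_0_iff_dvd by (elim dvdE)
    show ?case
    proof (cases "e q * w \<in> C")
      case True
      have "q \<noteq> 0" using q Suc by auto
      then have "degree p = Suc (degree q)"
        unfolding q by (subst degree_mult_eq) auto
      with Suc.hyps(2) have "d = degree q" by simp
      from Suc.hyps(1)[OF this \<open>q \<noteq> 0\<close> True] show ?thesis .
    next
      case False
      have "e [:-a, 1:] * (e q * w) \<in> C"
        using Suc.prems(2) by (simp only: q hom_mult mult.assoc)
      with False show ?thesis by blast
    qed
  qed
  then show thesis using that by blast
qed

text \<open>
  A finite-dimensional module over \<open>K[X, Y]\<close>, with \<open>K\<close> algebraically closed, contains a common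
  eigenvector of \<open>X\<close> and \<open>Y\<close>; the pair of eigenvalues is the common zero.
\<close>

lemma ideal_common_zero:
  fixes C :: "'k::alg_closed_field poly poly set"
  assumes C: "ideal.subspace C" and one: "1 \<notin> C"
    and p: "p \<noteq> 0" "[:p:] \<in> C" and q: "q \<noteq> 0" "in_Y q \<in> C"
  obtains a b where "\<And>f. f \<in> C \<Longrightarrow> eval2 f a b = 0"
proof -
  have "[:p:] * 1 \<in> C"
    using p(2) by (simp only: mult_1_right)
  from ex_linear_factor_annihilator[OF const_poly.comm_ring_hom_axioms C p(1) this one]
  obtain a p' where p': "[:p':] * 1 \<notin> C" "[:[:-a, 1:]:] * ([:p':] * 1) \<in> C"
    by metis
  \<comment> \<open>Modulo C, r is an eigenvector of X. Multiplying it by a polynomial in Y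
    preserves this and yields t, an eigenvector of Y as well.\<close>
  define r where "r = [:p':] * 1"
  have r: "r \<notin> C" "[:[:-a, 1:]:] * r \<in> C"
    using p' by (simp_all only: r_def not_False_eq_True)
  have "in_Y q * r \<in> C"
    using ideal.subspace_scale[OF C q(2), of r] by (simp only: mult.commute)
  from ex_linear_factor_annihilator[OF poly_in_Y.comm_ring_hom_axioms C q(1) this r(1)]
  obtain b s where s: "in_Y s * r \<notin> C"
    "in_Y [:-b, 1:] * (in_Y s * r) \<in> C"
    by metis
  define t where "t = in_Y s * r"
  have tX: "[:[:-a, 1:]:] * t \<in> C"
    using ideal.subspace_scale[OF C r(2), of "in_Y s"]
    by (simp only: t_def mult.left_commute)
  have tY: "[:[:-b:], 1:] * t \<in> C"
    using s(2) by (simp add: t_def map_poly_pCons)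
  show thesis
  proof (rule that)
    fix f assume f: "f \<in> C"
    obtain u v where uv: "f = [:[:eval2 f a b:]:] + [:[:-a, 1:]:] * u + [:[:-b:], 1:] * v"
      by (rule bivariate_taylor)
    \<comment> \<open>By the Taylor expansion f acts on t as the scalar f(a, b) modulo C. As f is in
      C and t is not, that scalar vanishes.\<close>
    have "t * f - (u * ([:[:-a, 1:]:] * t) + v * ([:[:-b:], 1:] * t)) \<in> C"
      by (intro ideal.subspace_diff ideal.subspace_add ideal.subspace_scale C f tX tY)
    also have "t * f - (u * ([:[:-a, 1:]:] * t) + v * ([:[:-b:], 1:] * t)) = [:[:eval2 f a b:]:] * t"
    proof -
      have "t * f - (u * (x * t) + v * (y * t)) = c * t" if "f = c + x * u + y * v" for c x y
        unfolding that by (simp only: algebra_simps)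
      from this[OF uv] show ?thesis .
    qed
    finally have *: "[:[:eval2 f a b:]:] * t \<in> C" .
    show "eval2 f a b = 0"
    proof (rule ccontr)
      assume nz: "eval2 f a b \<noteq> 0"
      have "[:[:inverse (eval2 f a b):]:] * ([:[:eval2 f a b:]:] * t) \<in> C"
        by (intro ideal.subspace_scale C *)
      then show False
        using s(1) nz by (simp add: t_def[symmetric] one_pCons[symmetric] del: mult_pCons_right)
    qed
  qed
qed

text \<open>Modulo I, x u = - y v, hence u^s x^s y^t is a multiple of y^(s+t), which r sends into I.
  In the applications u^s r does not vanish at the point considered, so x^s y^t lies in I
  locally.\<close>

lemma local_membership:
  fixes x y :: "'a::comm_ring_1"
  assumes I: "ideal.subspace I" "x * u + y * v \<in> I" "y ^ b * r \<in> I" and le: "b \<le> s + t"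
  shows "u ^ s * r * (x ^ s * y ^ t) \<in> I"
proof -
  have "\<exists>w. z ^ s - z' ^ s = (z - z') * w" for z z' :: 'a
    using power_diff_sumr2 by blast
  from this[of "x * u" "y * (- v)"]
  obtain w where w: "(x * u) ^ s - (y * (- v)) ^ s = (x * u + y * v) * w"
    by auto
  have y: "y ^ (s + t) = y ^ (s + t - b) * y ^ b"
    using le by (simp flip: power_add)
  have "u ^ s * r * (x ^ s * y ^ t)
      = (u ^ s * x ^ s - y ^ s * (- v) ^ s) * (r * y ^ t) + (- v) ^ s * r * (y ^ s * y ^ t)"
    by (simp only: algebra_simps)
  also have "u ^ s * x ^ s - y ^ s * (- v) ^ s = (x * u + y * v) * w"
    unfolding w[symmetric] power_mult_distrib by (simp only: mult.commute)
  also have "y ^ s * y ^ t = y ^ (s + t - b) * y ^ b"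
    using y by (simp only: power_add)
  also have "(x * u + y * v) * w * (r * y ^ t) + (- v) ^ s * r * (y ^ (s + t - b) * y ^ b)
      = (w * (r * y ^ t)) * (x * u + y * v) + ((- v) ^ s * y ^ (s + t - b)) * (y ^ b * r)"
    by (simp only: mult_ac)
  also have "\<dots> \<in> I"
    by (intro ideal.subspace_add ideal.subspace_scale I)
  finally show ?thesis .
qed

text \<open>With \<open>U = 0\<close> this is the ideal of relations (Q_n(X), Q_m(Y)); congruences
  between configurations are expressed in that form later.\<close>

definition grid_ideal :: "nat \<Rightarrow> nat \<Rightarrow> 'a::comm_ring_1 poly poly \<Rightarrow> 'a poly poly set" where
  "grid_ideal n m U = ideal.span {U, [:Q_seq [:0, 1:] n:], in_Y (Q_seq [:0, 1:] m)}"

definition symmetric_gen :: "nat \<Rightarrow> nat \<Rightarrow> 'a::comm_ring_1 poly poly" where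
  "symmetric_gen n m = [:half_Q [:0, 1:] n:] * in_Y (half_Q [:0, 1:] m)"

lemma mem_span_triple:
  "x \<in> ideal.span {a, b, c} \<longleftrightarrow> (\<exists>f g h. x = f * a + g * b + h * c)"
  unfolding ideal.span_insert ideal.span_empty by (auto simp: algebra_simps)

section \<open>Membership of S_n(X) S_m(Y), tested at common zeros\<close>

lemma eval2_simps [simp]:
  "eval2 (f + g) a b = eval2 f a b + eval2 g a b"
  "eval2 (f * g) a b = eval2 f a b * eval2 g a b"
  "eval2 (f ^ k) a b = eval2 f a b ^ k"
  "eval2 [:p:] a b = poly p a"
  "eval2 (in_Y q) a b = poly q b"
  for f g :: "'a::comm_ring_1 poly poly"
  by (simp_all add: eval2_def)

lemma poly_poly_eq_eval2: "poly (poly V \<phi>) x = eval2 V x (poly \<phi> x)"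
  for V :: "'a::comm_ring_1 poly poly"
  by (induction V) (simp_all add: eval2_def)

lemma char2_poly: "(2::'a::comm_ring_1) = 0 \<Longrightarrow> (2::'a poly) = 0"
  by (metis of_nat_numeral of_nat_poly pCons_0_0)

lemma order_Q_seq_half:
  assumes char2: "(2::'a::field) = 0" and "n > 0"
  shows "Polynomial.order a (Q_seq [:0, 1::'a:] n)
    = 2 * Polynomial.order a (half_Q [:0, 1::'a:] n) + (if odd n \<and> a = 0 then 1 else 0)"
proof -
  have Q: "Q_seq [:0, 1::'a:] n = (if odd n then [:0, 1:] else 1) * (half_Q [:0, 1:] n)\<^sup>2"
    by (rule Q_seq_eq_half_Q[OF char2_poly[OF char2] \<open>n > 0\<close>])
  let ?E = "if odd n then [:0, 1:] else (1 :: 'a poly)"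
  let ?H = "half_Q [:0, 1::'a:] n"
  have nz: "?E * (?H * ?H) \<noteq> 0"
    using Q_seq_X_nonzero[of n, where 'a = 'a] unfolding Q power2_eq_square .
  then have "?H * ?H \<noteq> 0" by (rule contrapos_nn) (simp only: mult_zero_right)
  from order_mult[OF nz, of a] order_mult[OF this, of a]
  have "Polynomial.order a (Q_seq [:0, 1:] n) = Polynomial.order a ?E + 2 * Polynomial.order a ?H"
    unfolding Q power2_eq_square by (simp only: mult_2)
  moreover have "Polynomial.order a [:0, 1:] = (if a = 0 then 1 else 0)"
    using order_power_n_n[of a 1] by (auto intro: order_0I)
  ultimately show ?thesis
    by auto
qed

lemma order_factor:
  fixes p :: "'a::field poly"
  assumes "p \<noteq> 0"
  obtains q where "p = [:-a, 1:] ^ Polynomial.order a p * q" "poly q a \<noteq> 0"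
  using order_decomp[OF assms, of a] by (auto simp: poly_eq_0_iff_dvd)

text \<open>If w = S_n(X) S_m(Y) were outside the ideal, the conductor C of all f with f w in the
  ideal would be proper and so have a common zero (a, b). Outside the exceptional case, local
  membership supplies an element of C not vanishing there.\<close>

lemma symmetric_gen_mem_grid_ideal:
  fixes V :: "'k::alg_closed_field poly poly"
  assumes char2: "(2::'k) = 0" and n: "n > 0" and m: "m > 0"
    and roots: "\<And>a b. \<lbrakk>poly (Q_seq [:0, 1:] n) a = 0; poly (Q_seq [:0, 1:] m) b = 0; eval2 V a b = 0\<rbrakk> \<Longrightarrow>
      (Polynomial.order a (Q_seq [:0, 1:] n) \<ge> 2 \<longrightarrow> eval2 (deriv_X V) a b \<noteq> 0) \<and>
      (Polynomial.order b (Q_seq [:0, 1:] m) \<ge> 2 \<longrightarrow> eval2 (deriv_Y V) a b \<noteq> 0)"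
    and not_exceptional: "\<not> (odd n \<and> odd m \<and> eval2 V 0 0 = 0 \<and>
      multiplicity 2 (n + 1) = multiplicity 2 (m + 1))"
  shows "symmetric_gen n m \<in> grid_ideal n m V"
proof (rule ccontr)
  define I where "I = grid_ideal n m V"
  define w where "w = (symmetric_gen n m :: 'k poly poly)"
  define Qn where "Qn = Q_seq [:0, 1::'k:] n"
  define Qm where "Qm = Q_seq [:0, 1::'k:] m"
  define Sn where "Sn = half_Q [:0, 1::'k:] n"
  define Sm where "Sm = half_Q [:0, 1::'k:] m"
  assume "symmetric_gen n m \<notin> grid_ideal n m V"
  then have w: "w \<notin> I" by (simp add: w_def I_def)
  have I: "ideal.subspace I"
    by (simp add: I_def grid_ideal_def)
  have gens: "V \<in> I" "[:Qn:] \<in> I" "in_Y Qm \<in> I"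
    by (auto simp: I_def grid_ideal_def Qn_def Qm_def intro!: ideal.span_base)
  define C where "C = {f. f * w \<in> I}"
  have C: "ideal.subspace C"
  proof (rule ideal.subspaceI)
    show "0 \<in> C"
      using ideal.subspace_0[OF I] by (simp add: C_def)
    show "f + g \<in> C" if "f \<in> C" "g \<in> C" for f g
      using ideal.subspace_add[OF I] that by (simp only: C_def mem_Collect_eq distrib_right)
    show "c * f \<in> C" if "f \<in> C" for c f
      using ideal.subspace_scale[OF I] that by (simp only: C_def mem_Collect_eq mult.assoc)
  qed
  have IC: "f \<in> C" if "f \<in> I" for f
    using ideal.subspace_scale[OF I that, of w] by (simp only: C_def mem_Collect_eq mult.commute)
  have nz: "Qn \<noteq> 0" "Qm \<noteq> 0"
    unfolding Qn_def Qm_def by (rule Q_seq_X_nonzero)+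
  have "1 \<notin> C"
    using w by (simp add: C_def)
  from ideal_common_zero[OF C this nz(1) IC[OF gens(2)] nz(2) IC[OF gens(3)]]
  obtain a b where ab: "\<And>f. f \<in> C \<Longrightarrow> eval2 f a b = 0"
    by metis
  have Vab: "eval2 V a b = 0"
    using ab[OF IC[OF gens(1)]] .
  have Qab: "poly Qn a = 0" "poly Qm b = 0"
    using ab[OF IC[OF gens(2)]] ab[OF IC[OF gens(3)]] by simp_all
  obtain u v where uv: "V = [:[:eval2 V a b:]:] + [:[:-a, 1:]:] * u + [:[:-b:], 1:] * v"
    "eval2 u a b = eval2 (deriv_X V) a b" "eval2 v a b = eval2 (deriv_Y V) a b"
    by (rule bivariate_taylor)
  define P where "P = [:[:-a, 1:]:]"
  define L where "L = [:[:-b:], 1:]"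
  have L: "L = in_Y [:-b, 1:]"
    by (simp add: L_def map_poly_pCons)
  have V: "V = P * u + L * v"
    using uv(1) unfolding Vab P_def[symmetric] L_def[symmetric] by simp
  have Snz: "Sn \<noteq> 0" "Sm \<noteq> 0"
    using nz Q_seq_eq_half_Q[OF char2_poly[OF char2] n, of "[:0, 1:]"]
      Q_seq_eq_half_Q[OF char2_poly[OF char2] m, of "[:0, 1:]"]
    unfolding Qn_def Qm_def Sn_def Sm_def by auto
  define A B s t where "A = Polynomial.order a Qn" and "B = Polynomial.order b Qm"
    and "s = Polynomial.order a Sn" and "t = Polynomial.order b Sm"
  have A: "A = 2 * s + (if odd n \<and> a = 0 then 1 else 0)"
    unfolding A_def s_def Qn_def Sn_def by (rule order_Q_seq_half[OF char2 n])
  have B: "B = 2 * t + (if odd m \<and> b = 0 then 1 else 0)"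
    unfolding B_def t_def Qm_def Sm_def by (rule order_Q_seq_half[OF char2 m])
  obtain q where q: "Qn = [:-a, 1:] ^ A * q" "poly q a \<noteq> 0"
    using order_factor[OF nz(1)] A_def by metis
  obtain r where r: "Qm = [:-b, 1:] ^ B * r" "poly r b \<noteq> 0"
    using order_factor[OF nz(2)] B_def by metis
  obtain \<sigma> where \<sigma>: "Sn = [:-a, 1:] ^ s * \<sigma>"
    using order_factor[OF Snz(1)] s_def by metis
  obtain \<tau> where \<tau>: "Sm = [:-b, 1:] ^ t * \<tau>"
    using order_factor[OF Snz(2)] t_def by metis
  have w_eq: "w = (P ^ s * L ^ t) * ([:\<sigma>:] * in_Y \<tau>)"
    unfolding w_def symmetric_gen_def Sn_def[symmetric] Sm_def[symmetric] \<sigma> \<tau> P_def L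
    by (simp only: const_poly.hom_mult const_poly.hom_power poly_in_Y.hom_mult poly_in_Y.hom_power mult_ac)
  have P_mem: "P ^ A * [:q:] \<in> I"
    using gens(2) by (simp only: q(1) P_def const_poly.hom_mult const_poly.hom_power)
  have L_mem: "L ^ B * in_Y r \<in> I"
    using gens(3) by (simp only: r(1) L poly_in_Y.hom_mult poly_in_Y.hom_power)
  have V_mem: "P * u + L * v \<in> I" "L * v + P * u \<in> I"
    using gens(1) V by (simp_all add: add.commute)
  have roots_ab: "(A \<ge> 2 \<longrightarrow> eval2 u a b \<noteq> 0) \<and> (B \<ge> 2 \<longrightarrow> eval2 v a b \<noteq> 0)"
    unfolding uv(2,3) A_def B_def Qn_def Qm_def
    using roots Qab Vab unfolding Qn_def Qm_def by blast
  \<comment> \<open>As w is a multiple of P^s L^t, whatever multiplies P^s L^t into I also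
    multiplies w into I and belongs to C.\<close>
  have no_mult: "eval2 g a b = 0" if "g * (P ^ s * L ^ t) \<in> I" for g
  proof (rule ab)
    have "([:\<sigma>:] * in_Y \<tau>) * (g * (P ^ s * L ^ t)) \<in> I"
      using I that by (rule ideal.subspace_scale)
    then show "g \<in> C"
      unfolding C_def w_eq by (simp only: mult_ac mem_Collect_eq)
  qed
  \<comment> \<open>If t < s then B <= 2 t + 1 <= s + t, and symmetrically if s < t. When s = t,
    both bounds fail only if A and B are odd, which puts (a, b) at the origin with n and m
    odd.\<close>
  consider "B \<le> s + t" | "A \<le> s + t" | "odd n \<and> odd m \<and> a = 0 \<and> b = 0 \<and> s = t"
    using A B by (cases "s = t"; cases "s < t") (auto split: if_splits)
  then show False
  proof cases
    case 1
    have "eval2 (u ^ s * in_Y r) a b = 0"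
      by (rule no_mult, rule local_membership[OF I V_mem(1) L_mem 1])
    \<comment> \<open>Since r(b) is nonzero, u^s vanishes at (a, b). So s > 0 and A >= 2, which is
      the case where the derivative condition makes u(a, b) nonzero.\<close>
    then have "s > 0" "eval2 u a b = 0"
      using r(2) by auto
    then show False
      using roots_ab A by auto
  next
    case 2
    then have "A \<le> t + s" by simp
    from local_membership[OF I V_mem(2) P_mem this]
    have "eval2 (v ^ t * [:q:]) a b = 0"
      by (intro no_mult) (simp only: mult.commute[of "L ^ t"])
    then have "eval2 v a b ^ t * poly q a = 0"
      by (simp only: eval2_simps)
    then have "t > 0" "eval2 v a b = 0"
      using q(2) by auto
    then show False
      using roots_ab B by auto
  next
    case 3
    then have "A = B" using A B by simp
    then have "(2::nat) ^ multiplicity 2 (n + 1) = 2 ^ multiplicity 2 (m + 1)"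
      using 3 order_0_Q_seq_X[OF char2] by (metis A_def B_def Qn_def Qm_def)
    then show False
      using not_exceptional 3 Vab by simp
  qed
qed

text \<open>Newton iteration for a branch Y = phi(X) of V = 0, one power of X per step. The base
  case takes phi = 0, hence the disjunction in the hypothesis.\<close>

lemma hensel_root:
  fixes V :: "'a::field poly poly"
  assumes V0: "eval2 V 0 0 = 0" and dV: "k = 0 \<or> eval2 (deriv_Y V) 0 0 \<noteq> 0"
  obtains \<phi> where "poly \<phi> 0 = 0" "[:0, 1:] ^ Suc k dvd poly V \<phi>"
proof -
  have "\<exists>\<phi>. poly \<phi> 0 = 0 \<and> [:0, 1:] ^ Suc k dvd poly V \<phi>"
    using dV
  proof (induction k)
    case 0
    have "poly (poly V 0) 0 = 0"
      using V0 by (simp add: eval2_def)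
    then have "[:0, 1:] dvd poly V 0"
      by (simp add: poly_eq_0_iff_dvd)
    then show ?case by (intro exI[of _ 0]) simp
  next
    case (Suc k)
    then have d: "eval2 (deriv_Y V) 0 0 \<noteq> 0" by simp
    with Suc.IH obtain \<phi> where \<phi>: "poly \<phi> 0 = 0" "[:0, 1:] ^ Suc k dvd poly V \<phi>"
      by blast
    then obtain g where g: "poly V \<phi> = [:0, 1:] ^ Suc k * g"
      by (elim dvdE)
    have "poly (V - [:poly V \<phi>:]) \<phi> = 0" by simp
    then obtain W where W: "V - [:poly V \<phi>:] = [:-\<phi>, 1:] * W"
      unfolding poly_eq_0_iff_dvd by (elim dvdE)
    then have VW: "V = [:poly V \<phi>:] + [:-\<phi>, 1:] * W"
      by (simp only: diff_eq_eq add.commute)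
    have dW: "poly (pderiv V) \<phi> = poly W \<phi>"
      by (subst VW, subst pderiv_add, subst pderiv_mult) (simp add: pderiv_pCons)
    \<comment> \<open>Adding e X^(k+1) to phi changes the coefficient of X^(k+1) in V(phi) by e
      times the Y-derivative at the origin; this value of e cancels it.\<close>
    define e where "e = - poly g 0 / eval2 (deriv_Y V) 0 0"
    define c where "c = [:0, 1:] ^ Suc k * [:e:]"
    have c0: "poly c 0 = 0" by (simp add: c_def)
    have "poly V (\<phi> + c) = poly V \<phi> + c * poly W (\<phi> + c)"
      by (subst VW) (simp add: distrib_right)
    also have "\<dots> = [:0, 1:] ^ Suc k * (g + [:e:] * poly W (\<phi> + c))"
      unfolding g c_def by (simp only: distrib_left mult.assoc)
    finally have *: "poly V (\<phi> + c) = [:0, 1:] ^ Suc k * (g + [:e:] * poly W (\<phi> + c))" .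
    have "poly (poly W (\<phi> + c)) 0 = poly (poly W \<phi>) 0"
      using \<phi>(1) c0 by (simp add: poly_poly_eq_eval2)
    also have "\<dots> = eval2 (deriv_Y V) 0 0"
      using \<phi>(1) by (simp add: deriv_Y_def poly_poly_eq_eval2 flip: dW)
    finally have "poly (g + [:e:] * poly W (\<phi> + c)) 0 = 0"
      using d by (simp add: e_def)
    then have "[:0, 1:] dvd g + [:e:] * poly W (\<phi> + c)"
      by (simp only: poly_eq_0_iff_dvd minus_zero)
    then have "[:0, 1:] ^ Suc k * [:0, 1:] dvd poly V (\<phi> + c)"
      unfolding * by (rule mult_dvd_mono[OF dvd_refl])
    then have "[:0, 1:] ^ Suc (Suc k) dvd poly V (\<phi> + c)"
      by (simp only: power_Suc2)
    then show ?case
      using \<phi>(1) c0 by (intro exI[of _ "\<phi> + c"]) simp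
  qed
  then show thesis using that by blast
qed

text \<open>
  The ideal vanishes to order \<open>2 s + 1\<close> along a branch \<open>Y = \<phi>(X)\<close> of the curve \<open>U = 0\<close> through the
  origin, whereas the generator of the symmetric configurations vanishes only to order \<open>2 s\<close>.
\<close>

lemma symmetric_gen_not_mem_grid_ideal:
  fixes V :: "'a::field poly poly"
  assumes char2: "(2::'a) = 0" and odd: "odd n" "odd m"
    and V0: "eval2 V 0 0 = 0" and eq: "multiplicity 2 (n + 1) = multiplicity 2 (m + 1)"
    and deriv: "Polynomial.order 0 (Q_seq [:0, 1::'a:] n) \<ge> 2 \<longrightarrow>
      eval2 (deriv_X V) 0 0 \<noteq> 0 \<and> eval2 (deriv_Y V) 0 0 \<noteq> 0"
  shows "symmetric_gen n m \<notin> grid_ideal n m V"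
proof
  define Qn where "Qn = Q_seq [:0, 1::'a:] n"
  define Qm where "Qm = Q_seq [:0, 1::'a:] m"
  define Sn where "Sn = half_Q [:0, 1::'a:] n"
  define Sm where "Sm = half_Q [:0, 1::'a:] m"
  define s where "s = Polynomial.order 0 Sn"
  have n: "n > 0" and m: "m > 0"
    using odd by (auto intro: odd_pos)
  have nz: "Qn \<noteq> 0" "Qm \<noteq> 0"
    unfolding Qn_def Qm_def by (rule Q_seq_X_nonzero)+
  have Snz: "Sn \<noteq> 0" "Sm \<noteq> 0"
    using nz Q_seq_eq_half_Q[OF char2_poly[OF char2] n, of "[:0, 1:]"]
      Q_seq_eq_half_Q[OF char2_poly[OF char2] m, of "[:0, 1:]"]
    unfolding Qn_def Qm_def Sn_def Sm_def by auto
  have On: "Polynomial.order 0 Qn = Suc (2 * s)"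
    using order_Q_seq_half[OF char2 n, of 0] odd by (simp add: Qn_def Sn_def s_def)
  have "Polynomial.order 0 Qn + 1 = Polynomial.order 0 Qm + 1"
    unfolding Qn_def Qm_def order_0_Q_seq_X[OF char2] eq ..
  then have Om: "Polynomial.order 0 Qm = Suc (2 * s)"
    using On by simp
  then have s': "Polynomial.order 0 Sm = s"
    using order_Q_seq_half[OF char2 m, of 0] odd by (simp add: Qm_def Sm_def)
  obtain q where q: "Qn = [:0, 1:] ^ Suc (2 * s) * q"
    using order_factor[OF nz(1), of 0] On by (metis minus_zero)
  obtain r where r: "Qm = [:0, 1:] ^ Suc (2 * s) * r"
    using order_factor[OF nz(2), of 0] Om by (metis minus_zero)
  obtain \<sigma> where \<sigma>: "Sn = [:0, 1:] ^ s * \<sigma>" "poly \<sigma> 0 \<noteq> 0"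
    using order_factor[OF Snz(1), of 0] s_def by (metis minus_zero)
  obtain \<tau> where \<tau>: "Sm = [:0, 1:] ^ s * \<tau>" "poly \<tau> 0 \<noteq> 0"
    using order_factor[OF Snz(2), of 0] s' by (metis minus_zero)
  have d: "s = 0 \<or> eval2 (deriv_X V) 0 0 \<noteq> 0 \<and> eval2 (deriv_Y V) 0 0 \<noteq> 0"
    using deriv On by (auto simp: Qn_def)
  then obtain \<phi> where \<phi>: "poly \<phi> 0 = 0" "[:0, 1:] ^ Suc (2 * s) dvd poly V \<phi>"
    using hensel_root[OF V0, of "2 * s"] by auto
  then obtain \<psi> where \<psi>: "\<phi> = [:0, 1:] * \<psi>"
    unfolding poly_eq_0_iff_dvd minus_zero by (elim dvdE)
  \<comment> \<open>For s > 0 the slope psi(0) of the branch is nonzero: the linear coefficient of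
    V(phi) is V_X + psi(0) V_Y at the origin and vanishes, while V_X does not. For s = 0 the power
    is 1.\<close>
  have \<psi>0: "poly \<psi> 0 ^ s \<noteq> 0"
  proof (cases "s = 0")
    case False
    obtain u v where uv: "V = [:[:eval2 V 0 0:]:] + [:[:-0, 1:]:] * u + [:[:-0:], 1:] * v"
      "eval2 u 0 0 = eval2 (deriv_X V) 0 0" "eval2 v 0 0 = eval2 (deriv_Y V) 0 0"
      by (rule bivariate_taylor)
    have "poly V \<phi> = [:0, 1:] * (poly u \<phi> + \<psi> * poly v \<phi>)"
      by (subst uv(1)) (simp add: V0 \<psi> algebra_simps)
    moreover have "[:0, 1::'a:] ^ Suc (2 * s) = [:0, 1:] * ([:0, 1:] * [:0, 1:] ^ (2 * s - 1))"
      using False by (metis power_Suc Suc_pred' mult_pos_pos pos2 neq0_conv)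
    ultimately have "[:0, 1:] * ([:0, 1:] * [:0, 1:] ^ (2 * s - 1)) dvd [:0, 1:] * (poly u \<phi> + \<psi> * poly v \<phi>)"
      using \<phi>(2) by (simp only:)
    then have "[:0, 1:] * [:0, 1:] ^ (2 * s - 1) dvd poly u \<phi> + \<psi> * poly v \<phi>"
      by (subst (asm) dvd_mult_cancel_left) auto
    then have "[:0, 1:] dvd poly u \<phi> + \<psi> * poly v \<phi>"
      by (rule dvd_mult_left)
    then have "poly (poly u \<phi> + \<psi> * poly v \<phi>) 0 = 0"
      by (simp only: poly_eq_0_iff_dvd minus_zero)
    then have "eval2 u 0 0 + poly \<psi> 0 * eval2 v 0 0 = 0"
      using \<phi>(1) by (simp add: poly_poly_eq_eval2)
    then show ?thesis
      using d uv(2) False by auto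
  qed simp
  have in_Y_sub: "poly (in_Y p) \<phi> = pcompose p \<phi>" for p :: "'a poly"
    by (simp add: pcompose_altdef)
  assume "symmetric_gen n m \<in> grid_ideal n m V"
  then obtain f g h where "[:Sn:] * in_Y Sm = f * V + g * [:Qn:] + h * in_Y Qm"
    unfolding grid_ideal_def symmetric_gen_def mem_span_triple Sn_def Sm_def Qn_def Qm_def by blast
  \<comment> \<open>Restrict the relation to the branch by substituting Y = phi. All terms on the
    right become divisible by X^(2s+1), whereas the left side is X^(2s) times a polynomial that is
    nonzero at 0.\<close>
  from arg_cong[OF this, of "\<lambda>p. poly p \<phi>"]
  have *: "Sn * pcompose Sm \<phi> = poly f \<phi> * poly V \<phi> + poly g \<phi> * Qn + poly h \<phi> * pcompose Qm \<phi>"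
    by (simp add: in_Y_sub)
  have "[:0, 1:] ^ Suc (2 * s) dvd \<phi> ^ Suc (2 * s)"
    unfolding \<psi> power_mult_distrib by (rule dvd_triv_left)
  moreover have "pcompose Qm \<phi> = \<phi> ^ Suc (2 * s) * pcompose r \<phi>"
    unfolding r pcompose_mult pcompose_hom.hom_power by (simp add: pcompose_pCons)
  ultimately have "[:0, 1:] ^ Suc (2 * s) dvd pcompose Qm \<phi>"
    by simp
  moreover have "[:0, 1:] ^ Suc (2 * s) dvd Qn"
    unfolding q by (rule dvd_triv_left)
  ultimately have "[:0, 1:] ^ Suc (2 * s) dvd Sn * pcompose Sm \<phi>"
    unfolding * using \<phi>(2) by (intro dvd_add dvd_mult)
  also have "Sn * pcompose Sm \<phi> = [:0, 1:] ^ (2 * s) * (\<psi> ^ s * \<sigma> * pcompose \<tau> \<phi>)"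
  proof -
    have "pcompose Sm \<phi> = \<phi> ^ s * pcompose \<tau> \<phi>"
      unfolding \<tau>(1) pcompose_mult pcompose_hom.hom_power by (simp add: pcompose_pCons)
    then show ?thesis
      unfolding \<sigma>(1) \<psi> power_mult_distrib mult_2 power_add by (simp only: mult_ac)
  qed
  finally have "[:0, 1:] ^ (2 * s) * [:0, 1:] dvd [:0, 1:] ^ (2 * s) * (\<psi> ^ s * \<sigma> * pcompose \<tau> \<phi>)"
    by (simp only: power_Suc2)
  then have "[:0, 1:] dvd \<psi> ^ s * \<sigma> * pcompose \<tau> \<phi>"
    by (subst (asm) dvd_mult_cancel_left) auto
  then have "poly (\<psi> ^ s * \<sigma> * pcompose \<tau> \<phi>) 0 = 0"
    by (simp only: poly_eq_0_iff_dvd minus_zero)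
  then show False
    using \<psi>0 \<sigma>(2) \<tau>(2) \<phi>(1) by (simp add: poly_pcompose)
qed

section \<open>Descent from the algebraic closure\<close>

interpretation to_ac_hom: idom_hom "to_ac :: 'a::field \<Rightarrow> 'a alg_closure"
  by unfold_locales simp_all
interpretation to_ac_poly: map_poly_idom_hom "to_ac :: 'a::field \<Rightarrow> 'a alg_closure" ..
interpretation to_ac_poly_poly: map_poly_idom_hom "map_poly (to_ac :: 'a::field \<Rightarrow> 'a alg_closure)" ..

abbreviation to_ac2 :: "'a::field poly poly \<Rightarrow> 'a alg_closure poly poly" where
  "to_ac2 \<equiv> map_poly (map_poly to_ac)"

lemma to_ac_Q_seq: "map_poly to_ac (Q_seq [:0, 1:] n) = Q_seq [:0, 1:] n"
  unfolding to_ac_poly.hom_Q_seq by (simp add: map_poly_pCons)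

lemma to_ac2_const: "to_ac2 [:p:] = [:map_poly to_ac p:]"
  by (simp add: to_ac_poly.map_poly_pCons_hom)

lemma to_ac2_in_Y: "to_ac2 (in_Y p) = in_Y (map_poly to_ac p)"
  by (induction p) (simp_all add: map_poly_pCons to_ac_hom.map_poly_pCons_hom to_ac_poly.map_poly_pCons_hom)

lemma to_ac2_symmetric_gen: "to_ac2 (symmetric_gen n m) = symmetric_gen n m"
proof -
  have "map_poly to_ac (half_Q [:0, 1:] n) = half_Q [:0, 1::'a alg_closure:] n" for n
    unfolding to_ac_poly.hom_half_Q by (simp add: map_poly_pCons)
  then show ?thesis
    unfolding symmetric_gen_def to_ac_poly_poly.hom_mult to_ac2_const to_ac2_in_Y by simp
qed

lemma eval2_ac_eq: "eval2_ac U = eval2 (to_ac2 U)"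
  by (simp add: eval2_ac_def fun_eq_iff)

lemma eval2_ac_0: "eval2_ac U 0 0 = to_ac (eval2 U 0 0)"
proof -
  have "poly (to_ac2 U) (map_poly to_ac 0) = map_poly to_ac (poly U 0)"
    by (rule to_ac_poly.poly_map_poly)
  moreover have "poly (map_poly to_ac (poly U 0)) (to_ac 0) = to_ac (poly (poly U 0) 0)"
    by (rule to_ac_hom.poly_map_poly)
  ultimately show ?thesis
    by (simp add: eval2_ac_def eval2_def)
qed

lemma deriv_X_to_ac2: "deriv_X (to_ac2 U) = to_ac2 (deriv_X U)"
  by (rule poly_eqI) (simp add: deriv_X_def coeff_map_poly to_ac_hom.map_poly_pderiv)

lemma deriv_Y_to_ac2: "deriv_Y (to_ac2 U) = to_ac2 (deriv_Y U)"
  by (simp add: deriv_Y_def to_ac_poly.map_poly_pderiv)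

text \<open>The vector 1 is independent over the base field, so a linear functional on the closure
  can be prescribed to be 1 there. Applied to coefficients it pushes identities down to the base
  field.\<close>

lemma alg_closure_linear_retraction:
  obtains l :: "'a::field alg_closure \<Rightarrow> 'a" where
    "\<And>x y. l (x + y) = l x + l y" "\<And>x c. l (x * to_ac c) = l x * c" "l 1 = 1"
proof -
  have 1: "Vector_Spaces.vector_space (\<lambda>c x. to_ac c * x :: 'a alg_closure)"
    by unfold_locales (simp_all only: distrib_left distrib_right to_ac_add to_ac_mult to_ac_1 mult.assoc mult_1_left)
  have 2: "Vector_Spaces.vector_space ((*) :: 'a \<Rightarrow> 'a \<Rightarrow> 'a)"
    by unfold_locales (simp_all only: distrib_left distrib_right mult.assoc mult_1_left)
  interpret vector_space_pair "\<lambda>c x. to_ac c * x :: 'a alg_closure" "(*) :: 'a \<Rightarrow> 'a \<Rightarrow> 'a"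
    using 1 2 by (rule vector_space_pair.intro)
  have "vs1.independent {1}"
    by (simp only: vs1.dependent_single one_neq_zero not_False_eq_True)
  from linear_independent_extend[OF this, of "\<lambda>_. 1"]
  obtain l :: "'a alg_closure \<Rightarrow> 'a" where lin: "Vector_Spaces.linear (\<lambda>c x. to_ac c * x) (*) l" and one: "l 1 = 1" by blast
  interpret l: Vector_Spaces.linear "\<lambda>c x. to_ac c * x :: 'a alg_closure" "(*) :: 'a \<Rightarrow> 'a \<Rightarrow> 'a" l
    by (rule lin)
  show thesis
  proof (rule that)
    show "l (x * to_ac c) = l x * c" for x c
      using l.scale[of c x] by (simp only: mult.commute)
  qed (rule l.add one)+
qed

text \<open>Linearity over constants lifts to linearity over polynomials. Because \<open>h\<close>
  is abstract, the lemma can be applied with \<open>to_ac\<close> and then with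
  \<open>map_poly to_ac\<close>, which reaches two variables.\<close>

lemma map_poly_semilinear:
  fixes l :: "'b::comm_ring_1 \<Rightarrow> 'a::comm_ring_1" and h :: "'a \<Rightarrow> 'b"
  assumes add: "\<And>x y. l (x + y) = l x + l y" and scale: "\<And>x c. l (x * h c) = l x * c"
    and h: "h 0 = 0"
  shows "map_poly l (p + q) = map_poly l p + map_poly l q"
    "map_poly l (p * map_poly h r) = map_poly l p * r"
proof -
  have l0: "l 0 = 0"
    using add[of 0 0] by simp
  have l_sum: "l (sum f A) = (\<Sum>i\<in>A. l (f i))" for f :: "nat \<Rightarrow> 'b" and A
    by (induction A rule: infinite_finite_induct) (simp_all add: add l0)
  show "map_poly l (p + q) = map_poly l p + map_poly l q"
    by (rule poly_eqI) (simp add: coeff_map_poly l0 add)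
  show "map_poly l (p * map_poly h r) = map_poly l p * r"
    by (rule poly_eqI) (simp add: coeff_map_poly l0 h coeff_mult l_sum scale)
qed

text \<open>The generators and the target have coefficients in the base field, so applying the
  retraction to a membership certificate changes only the cofactors.\<close>

lemma symmetric_gen_mem_descent:
  fixes U :: "'a::field poly poly"
  assumes "symmetric_gen n m \<in> grid_ideal n m (to_ac2 U)"
  shows "symmetric_gen n m \<in> grid_ideal n m U"
proof -
  obtain l :: "'a alg_closure \<Rightarrow> 'a" where l: "\<And>x y. l (x + y) = l x + l y"
    "\<And>x c. l (x * to_ac c) = l x * c" "l 1 = 1"
    using alg_closure_linear_retraction[where 'a = 'a] by blast
  define L where "L = map_poly (map_poly l)"
  have L_add: "L (p + q) = L p + L q" for p q
    unfolding L_def by (intro map_poly_semilinear[where h = "map_poly to_ac"])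
      (simp_all add: map_poly_semilinear[of l to_ac, OF l(1,2)])
  have L_scale: "L (p * to_ac2 q) = L p * q" for p q
    unfolding L_def by (intro map_poly_semilinear[where h = "map_poly to_ac"])
      (simp_all add: map_poly_semilinear[of l to_ac, OF l(1,2)])
  have L1: "L 1 = 1"
    by (simp add: L_def l(3))
  obtain f g h where "symmetric_gen n m
      = f * to_ac2 U + g * [:Q_seq [:0, 1:] n:] + h * in_Y (Q_seq [:0, 1:] m)"
    using assms unfolding grid_ideal_def mem_span_triple by blast
  then have "to_ac2 (symmetric_gen n m)
      = f * to_ac2 U + g * to_ac2 [:Q_seq [:0, 1:] n:] + h * to_ac2 (in_Y (Q_seq [:0, 1:] m))"
    unfolding to_ac2_symmetric_gen to_ac2_const to_ac2_in_Y to_ac_Q_seq .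
  then have "L (to_ac2 (symmetric_gen n m))
      = L (f * to_ac2 U + g * to_ac2 [:Q_seq [:0, 1:] n:] + h * to_ac2 (in_Y (Q_seq [:0, 1:] m)))"
    by (simp only:)
  moreover have "L (to_ac2 (symmetric_gen n m)) = symmetric_gen n m"
    using L_scale[of 1 "symmetric_gen n m"] by (simp only: L1 mult_1_left)
  ultimately have "symmetric_gen n m = L f * U + L g * [:Q_seq [:0, 1:] n:] + L h * in_Y (Q_seq [:0, 1:] m)"
    unfolding L_add L_scale by (simp only:)
  then show ?thesis
    unfolding grid_ideal_def mem_span_triple by blast
qed

text \<open>Membership is proved over the closure, where common zeros exist, and then descends.
  Non-membership is argued over \<open>bit\<close> itself, as it involves only the origin.\<close>

lemma symmetric_gen_mem_iff:
  fixes U :: "bit poly poly"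
  assumes n: "n > 0" and m: "m > 0" and roots: "roots_condition n m U"
  shows "symmetric_gen n m \<in> grid_ideal n m U \<longleftrightarrow>
    \<not> (odd n \<and> odd m \<and> eval2 U 0 0 = 0 \<and> multiplicity 2 (n + 1) = multiplicity 2 (m + 1))"
    (is "_ \<longleftrightarrow> \<not> ?E")
proof
  have "(2::bit alg_closure) = to_ac 2"
    by (rule to_ac_numeral[symmetric])
  then have char2: "(2::bit alg_closure) = 0"
    by simp
  have char2': "(2::bit) = 0" by simp
  assume mem: "symmetric_gen n m \<in> grid_ideal n m U"
  show "\<not> ?E"
  proof
    assume E: ?E
    \<comment> \<open>The order at 0 is determined by v_2(n + 1) whatever the field, which lets the
      root condition at the origin pass from the closure to \<open>bit\<close>.\<close>
    have "(2::nat) ^ multiplicity 2 (n + 1) = 2 ^ multiplicity 2 (m + 1)"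
      using E by simp
    then have orders: "Polynomial.order 0 (Q_seq [:0, 1:: bit:] n) = Polynomial.order 0 (Q_seq [:0, 1::bit alg_closure:] n)"
      "Polynomial.order 0 (Q_seq [:0, 1::bit alg_closure:] n) = Polynomial.order 0 (Q_seq [:0, 1::bit alg_closure:] m)"
      using order_0_Q_seq_X[OF char2, of n] order_0_Q_seq_X[OF char2, of m] order_0_Q_seq_X[OF char2', of n]
      by linarith+
    have root: "poly (Q_seq [:0, 1::bit alg_closure:] k) 0 = 0" if "odd k" for k
    proof -
      have "2 dvd k + 1" using that by simp
      then have "multiplicity 2 (k + 1) \<noteq> 0"
        by (simp add: multiplicity_eq_zero_iff)
      then have "(2::nat) ^ multiplicity 2 (k + 1) > 1"
        by (intro one_less_power) auto
      then show ?thesis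
        unfolding order_root using order_0_Q_seq_X[OF char2, of k] by linarith
    qed
    have "eval2_ac U 0 0 = 0"
      using E by (simp add: eval2_ac_0)
    then have "(Polynomial.order 0 (Q_seq [:0, 1::bit alg_closure:] n) \<ge> 2 \<longrightarrow>
        eval2_ac (deriv_X U) 0 0 \<noteq> 0 \<and> eval2_ac (deriv_Y U) 0 0 \<noteq> 0)"
      using roots root[of n] root[of m] E orders(2)
      unfolding roots_condition_def Q_poly_eq_Q_seq to_ac_Q_seq by metis
    then have "(Polynomial.order 0 (Q_seq [:0, 1::bit:] n) \<ge> 2 \<longrightarrow>
        eval2 (deriv_X U) 0 0 \<noteq> 0 \<and> eval2 (deriv_Y U) 0 0 \<noteq> 0)"
      unfolding eval2_ac_0 orders to_ac_eq_0_iff .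
    then show False
      using symmetric_gen_not_mem_grid_ideal[OF char2', of n m U] E mem by blast
  qed
next
  have "(2::bit alg_closure) = to_ac 2"
    by (rule to_ac_numeral[symmetric])
  then have char2: "(2::bit alg_closure) = 0"
    by simp
  assume "\<not> ?E"
  then have "\<not> (odd n \<and> odd m \<and> eval2 (to_ac2 U) 0 0 = 0 \<and> multiplicity 2 (n + 1) = multiplicity 2 (m + 1))"
    unfolding eval2_ac_eq[symmetric] eval2_ac_0 to_ac_eq_0_iff .
  from symmetric_gen_mem_grid_ideal[OF char2 n m _ this]
  have "symmetric_gen n m \<in> grid_ideal n m (to_ac2 U)"
    using roots unfolding roots_condition_def Q_poly_eq_Q_seq to_ac_Q_seq eval2_ac_eq
      deriv_X_to_ac2 deriv_Y_to_ac2 by blast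
  then show "symmetric_gen n m \<in> grid_ideal n m U"
    by (rule symmetric_gen_mem_descent)
qed

section \<open>Configurations as polynomials\<close>

lemma sum_div_mod:
  fixes f :: "nat \<Rightarrow> nat \<Rightarrow> 'a::comm_monoid_add"
  assumes "m > 0"
  shows "(\<Sum>k<n * m. f (k div m) (k mod m)) = (\<Sum>i<n. \<Sum>j<m. f i j)"
proof -
  have "(\<Sum>k<n * m. f (k div m) (k mod m)) = (\<Sum>i<n. \<Sum>k=i * m..<i * m + m. f (k div m) (k mod m))"
    by (rule sum.nat_group[symmetric])
  also have "\<dots> = (\<Sum>i<n. \<Sum>j<m. f i j)"
  proof (rule sum.cong[OF refl])
    fix i
    have "a div m = i \<and> a mod m = a - i * m" if "i * m \<le> a" "a < i * m + m" for a
      using that div_nat_eqI[of m i a] by (simp add: algebra_simps minus_mult_div_eq_mod[symmetric])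
    note div_mod = this
    show "(\<Sum>k=i * m..<i * m + m. f (k div m) (k mod m)) = (\<Sum>j<m. f i j)"
      by (rule sum.reindex_bij_witness[where i = "\<lambda>j. i * m + j" and j = "\<lambda>k. k - i * m"])
        (use \<open>m > 0\<close> div_mod in auto)
  qed
  finally show ?thesis .
qed

lemma sum_rotate:
  "(\<Sum>k\<in>K. \<Sum>j\<in>S. \<Sum>i\<in>T j. F k j i) = (\<Sum>j\<in>S. \<Sum>i\<in>T j. \<Sum>k\<in>K. F k j i)"
  by (subst sum.swap, rule sum.cong[OF refl], rule sum.swap)

text \<open>Each Q_j is monic of degree exactly j, so the top coefficient can be peeled off. The
  lemma is applied both over K and over K[X].\<close>

lemma triangular_Q_seq:
  fixes c :: "nat \<Rightarrow> 'a::idom"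
  assumes "(\<Sum>j<m. smult (c j) (Q_seq [:0, 1:] j)) = 0" "j < m"
  shows "c j = 0"
  using assms
proof (induction m)
  case (Suc m)
  have "coeff (\<Sum>j<m. smult (c j) (Q_seq [:0, 1:] j)) m = 0"
    unfolding coeff_sum
  proof (intro sum.neutral ballI)
    fix j assume "j \<in> {..<m}"
    then have "degree (Q_seq [:0, 1::'a:] j) < m"
      by (simp only: degree_Q_seq_X lessThan_iff)
    then show "coeff (smult (c j) (Q_seq [:0, 1:] j)) m = 0"
      by (simp only: coeff_smult coeff_eq_0 mult_zero_right)
  qed
  moreover have "coeff (Q_seq [:0, 1::'a:] m) m = 1"
    using lead_coeff_Q_seq_X[of m, where 'a = 'a] by (simp only: degree_Q_seq_X)
  ultimately have "c m = coeff (\<Sum>j<Suc m. smult (c j) (Q_seq [:0, 1:] j)) m"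
    by simp
  then have "c m = 0"
    unfolding Suc.prems(1) by simp
  with Suc show ?case
    by (cases "j = m") simp_all
qed simp

lemma degree_Q_seq_combination:
  fixes c :: "nat \<Rightarrow> 'a::idom"
  assumes "n > 0"
  shows "degree (\<Sum>i<n. smult (c i) (Q_seq [:0, 1:] i)) < n"
proof (rule degree_sum_less)
  fix i assume "i \<in> {..<n}"
  then have "degree (Q_seq [:0, 1::'a:] i) < n"
    by (simp only: degree_Q_seq_X lessThan_iff)
  with degree_smult_le show "degree (smult (c i) (Q_seq [:0, 1:] i)) < n"
    by (rule le_less_trans)
qed (rule assms)

text \<open>Pseudo-division by a monic polynomial is genuine division; the coefficient ring will be
  K[X], which is not a field.\<close>

lemma monic_division:
  fixes f g :: "'a::idom poly"
  assumes "lead_coeff g = 1" "degree g > 0"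
  obtains q r where "f = g * q + r" "degree r < degree g"
proof -
  have "g \<noteq> 0" using assms by auto
  obtain q r where qr: "pseudo_divmod f g = (q, r)"
    by force
  show thesis
    using pseudo_divmod[OF \<open>g \<noteq> 0\<close> qr] assms by (intro that[of q r]) auto
qed

text \<open>Column l adds the neighbours Q_(l+1) + Q_(l-1), which is x Q_l in characteristic 2. In
  the last column Q_n is missing; it becomes the correction term and will be a relation.\<close>

lemma column_sum_J:
  fixes x :: "'a::comm_ring_1"
  assumes char2: "(2::'a) = 0" and "l < n"
  shows "(\<Sum>i<n. if i = Suc l \<or> l = Suc i then Q_seq x i else 0)
    = x * Q_seq x l + (if Suc l = n then Q_seq x n else 0)"
proof -
  have "(\<Sum>i<n. if i = Suc l \<or> l = Suc i then Q_seq x i else 0)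
      = (\<Sum>i<n. if i = Suc l then Q_seq x i else 0) + (\<Sum>i<n. if l = Suc i then Q_seq x i else 0)"
    unfolding sum.distrib[symmetric] by (rule sum.cong) auto
  also have "(\<Sum>i<n. if l = Suc i then Q_seq x i else 0) = (if l = 0 then 0 else Q_seq x (l - 1))"
  proof (cases l)
    case (Suc k)
    then show ?thesis
      using \<open>l < n\<close> by simp
  qed simp
  also have "(\<Sum>i<n. if i = Suc l then Q_seq x i else 0) = (if Suc l < n then Q_seq x (Suc l) else 0)"
    by simp
  also have "(if Suc l < n then Q_seq x (Suc l) else 0) = Q_seq x (Suc l) + (if Suc l = n then Q_seq x n else 0)"
  proof (cases "n = Suc l")
    case False
    then show ?thesis using \<open>l < n\<close> by simp
  qed (simp add: add_self_char2[OF char2] del: Q_seq.simps)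
  also have "Q_seq x (Suc l) + (if Suc l = n then Q_seq x n else 0) + (if l = 0 then 0 else Q_seq x (l - 1))
      = x * Q_seq x l + (if Suc l = n then Q_seq x n else 0)"
    by (cases l) (simp_all add: ac_simps add_self_left_char2[OF char2])
  finally show ?thesis .
qed

text \<open>Vertex (i, j) is sent to Q_i(X) Q_j(Y) rather than X^i Y^j, because summing over
  neighbours then becomes multiplication by X or Y.\<close>

definition config_basis :: "nat \<Rightarrow> nat \<Rightarrow> 'a::comm_ring_1 poly poly" where
  "config_basis m k = [:Q_seq [:0, 1:] (k div m):] * in_Y (Q_seq [:0, 1:] (k mod m))"

definition config_poly :: "nat \<Rightarrow> nat \<Rightarrow> 'a::comm_ring_1 vec \<Rightarrow> 'a poly poly" where
  "config_poly n m x = (\<Sum>k<n * m. [:[:x $ k:]:] * config_basis m k)"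

lemma config_poly_diff:
  assumes "x \<in> carrier_vec (n * m)" "y \<in> carrier_vec (n * m)"
  shows "config_poly n m (x - y) = config_poly n m x - config_poly n m y"
proof -
  have "[:[:(x - y) $ k:]:] = [:[:x $ k:]:] - [:[:y $ k:]:]" if "k < n * m" for k
    using assms that by simp
  then have "[:[:(x - y) $ k:]:] * config_basis m k
      = [:[:x $ k:]:] * config_basis m k - [:[:y $ k:]:] * config_basis m k" if "k < n * m" for k
    using that by (simp only: left_diff_distrib)
  then show ?thesis
    unfolding config_poly_def sum_subtractf[symmetric] by (intro sum.cong) auto
qed

lemma config_poly_mult_mat_vec:
  assumes "N \<in> carrier_mat (n * m) (n * m)" "x \<in> carrier_vec (n * m)"
  shows "config_poly n m (N *\<^sub>v x) = (\<Sum>c<n * m. [:[:x $ c:]:] * config_poly n m (col N c))"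
proof -
  have "config_poly n m (N *\<^sub>v x)
      = (\<Sum>k<n * m. \<Sum>c<n * m. [:[:N $$ (k, c) * x $ c:]:] * config_basis m k)"
    unfolding config_poly_def
  proof (rule sum.cong)
    fix k assume "k \<in> {..<n * m}"
    then have "(N *\<^sub>v x) $ k = (\<Sum>c<n * m. N $$ (k, c) * x $ c)"
      using assms by (simp add: scalar_prod_def lessThan_atLeast0)
    then have "[:[:(N *\<^sub>v x) $ k:]:] = (\<Sum>c<n * m. [:[:N $$ (k, c) * x $ c:]:])"
      by (simp only: const_poly.hom_sum)
    then show "[:[:(N *\<^sub>v x) $ k:]:] * config_basis m k
        = (\<Sum>c<n * m. [:[:N $$ (k, c) * x $ c:]:] * config_basis m k)"
      by (simp only: sum_distrib_right)
  qed simp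
  also have "\<dots> = (\<Sum>c<n * m. \<Sum>k<n * m. [:[:N $$ (k, c) * x $ c:]:] * config_basis m k)"
    by (rule sum.swap)
  also have "\<dots> = (\<Sum>c<n * m. [:[:x $ c:]:] * config_poly n m (col N c))"
    unfolding config_poly_def sum_distrib_left
  proof (intro sum.cong refl)
    fix c k assume "c \<in> {..<n * m}" "k \<in> {..<n * m}"
    then have "[:[:N $$ (k, c) * x $ c:]:] = [:[:x $ c:]:] * [:[:col N c $ k:]:]"
      using assms by simp
    then show "[:[:N $$ (k, c) * x $ c:]:] * config_basis m k
        = [:[:x $ c:]:] * ([:[:col N c $ k:]:] * config_basis m k)"
      by (simp only: mult.assoc)
  qed
  finally show ?thesis .
qed

section \<open>Uniqueness of representatives modulo the relations\<close>

lemma subspace_grid_ideal: "ideal.subspace (grid_ideal n m U)"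
  by (simp add: grid_ideal_def)

lemma grid_ideal_eq_relations:
  "f \<in> grid_ideal n m U \<longleftrightarrow> (\<exists>g. f - g * U \<in> grid_ideal n m 0)"
  by (simp add: grid_ideal_def ideal.span_insert[of U] ideal.span_insert[of 0])

text \<open>
  Since \<open>Q_n(X)\<close> and \<open>Q_m(Y)\<close> are monic, every class modulo these two polynomials contains exactly
  one polynomial of the form \<open>config_poly n m x\<close>.
\<close>

lemma config_poly_eq_0_modulo:
  fixes x :: "'a::idom vec"
  assumes n: "n > 0" and m: "m > 0" and x: "x \<in> carrier_vec (n * m)"
    and mem: "config_poly n m x \<in> grid_ideal n m 0"
  shows "x = 0\<^sub>v (n * m)"
proof -
  \<comment> \<open>The coefficient of Q_j(Y), a polynomial in X of degree below n; the
    configuration is thus a combination of the Q_j over K[X].\<close>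
  define p where "p j = (\<Sum>i<n. smult (x $ (i * m + j)) (Q_seq [:0, 1:] i))" for j
  have in_Y_Q: "in_Y (Q_seq [:0, 1::'a:] j) = Q_seq [:0, 1:] j" for j
    unfolding poly_in_Y.hom_Q_seq poly_in_Y_X ..
  have "config_poly n m x
      = (\<Sum>k<n * m. [:[:x $ (k div m * m + k mod m):]:] * ([:Q_seq [:0, 1:] (k div m):] * Q_seq [:0, 1:] (k mod m)))"
    by (simp only: config_poly_def config_basis_def in_Y_Q div_mult_mod_eq)
  also have "\<dots> = (\<Sum>i<n. \<Sum>j<m. [:[:x $ (i * m + j):]:] * ([:Q_seq [:0, 1:] i:] * Q_seq [:0, 1:] j))"
    by (rule sum_div_mod[OF m])
  also have "\<dots> = (\<Sum>j<m. \<Sum>i<n. smult (smult (x $ (i * m + j)) (Q_seq [:0, 1:] i)) (Q_seq [:0, 1:] j))"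
    by (subst sum.swap) simp
  also have "\<dots> = (\<Sum>j<m. smult (p j) (Q_seq [:0, 1:] j))"
    by (simp only: p_def smult_sum)
  finally have cp: "config_poly n m x = (\<Sum>j<m. smult (p j) (Q_seq [:0, 1:] j))" .
  define Qn where "Qn = Q_seq [:0, 1::'a:] n"
  define Qm where "Qm = Q_seq [:0, 1::'a poly:] m"
  have dm: "degree Qm = m" "lead_coeff Qm = 1" "Qm \<noteq> 0"
    unfolding Qm_def by (rule degree_Q_seq_X lead_coeff_Q_seq_X Q_seq_X_nonzero)+
  have dn: "degree Qn = n"
    unfolding Qn_def by (rule degree_Q_seq_X)
  obtain g h where gh: "config_poly n m x = g * [:Qn:] + h * Qm"
    using mem unfolding grid_ideal_def mem_span_triple in_Y_Q Qn_def[symmetric] Qm_def[symmetric]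
    by auto
  \<comment> \<open>After reducing g modulo Q_m(Y), the difference from g2 Q_n(X) has Y-degree below
    m but is a multiple of Q_m(Y), so it is zero. Then each Y-coefficient is a multiple of Q_n(X) of
    X-degree below n, hence zero too.\<close>
  obtain g1 g2 where g: "g = Qm * g1 + g2" "degree g2 < m"
  proof -
    have "degree Qm > 0" using dm(1) m by simp
    from monic_division[OF dm(2) this, of g] show thesis
      using that unfolding dm(1) by blast
  qed
  have "degree (config_poly n m x) < m"
    unfolding cp by (rule degree_Q_seq_combination[OF m])
  moreover have "degree (g2 * [:Qn:]) < m"
    using g(2) by (intro le_less_trans[OF degree_mult_le]) simp
  ultimately have "degree (config_poly n m x - g2 * [:Qn:]) < m"
    by (rule degree_diff_less)
  moreover have eq: "config_poly n m x - g2 * [:Qn:] = Qm * (g1 * [:Qn:] + h)"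
    unfolding gh g(1) by (simp only: algebra_simps)
  ultimately have "g1 * [:Qn:] + h = 0"
    using dm by (metis degree_mult_eq le_add1 linorder_not_less)
  then have cp': "config_poly n m x = g2 * [:Qn:]"
    using eq by simp
  have "coeff (config_poly n m x) l = 0" for l
  proof (rule ccontr)
    assume nz: "coeff (config_poly n m x) l \<noteq> 0"
    have "coeff (config_poly n m x) l = Qn * coeff g2 l"
      by (simp add: cp')
    with nz have "degree (coeff (config_poly n m x) l) \<ge> n"
      by (auto simp: degree_mult_eq dn)
    moreover have "degree (coeff (config_poly n m x) l) < n"
      unfolding cp coeff_sum
    proof (rule degree_sum_less)
      fix j
      have "degree (p j) < n"
        unfolding p_def by (rule degree_Q_seq_combination[OF n])
      moreover have "coeff (Q_seq [:0, 1:] j) l = [:coeff (Q_seq [:0, 1::'a:] j) l:]"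
        unfolding in_Y_Q[symmetric] by (simp add: coeff_map_poly)
      ultimately show "degree (coeff (smult (p j) (Q_seq [:0, 1:] j)) l) < n"
        by (auto intro: le_less_trans[OF degree_smult_le])
    qed (rule n)
    ultimately show False by simp
  qed
  then have "(\<Sum>j<m. smult (p j) (Q_seq [:0, 1:] j)) = 0"
    unfolding cp[symmetric] by (simp add: poly_eq_iff)
  then have p0: "p j = 0" if "j < m" for j
    using triangular_Q_seq that by blast
  show ?thesis
  proof (rule eq_vecI)
    fix k assume "k < dim_vec (0\<^sub>v (n * m))"
    then have k: "k < n * m" by simp
    then have "k div m < n" "k mod m < m"
      using m by (auto simp: less_mult_imp_div_less)
    with triangular_Q_seq[of "\<lambda>i. x $ (i * m + k mod m)" n] p0[of "k mod m"]
    have "x $ (k div m * m + k mod m) = 0"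
      unfolding p_def by blast
    then show "x $ k = 0\<^sub>v (n * m) $ k"
      using k by simp
  qed (use x in simp)
qed

text \<open>N represents multiplication by f modulo the relations. Columns are the images of the
  unit vectors, so linearity extends this to all configurations.\<close>

definition acts_as :: "nat \<Rightarrow> nat \<Rightarrow> 'a::comm_ring_1 mat \<Rightarrow> 'a poly poly \<Rightarrow> bool" where
  "acts_as n m N f \<longleftrightarrow> N \<in> carrier_mat (n * m) (n * m) \<and>
    (\<forall>c<n * m. config_poly n m (col N c) - f * config_basis m c \<in> grid_ideal n m 0)"

lemma acts_as_carrier: "acts_as n m N f \<Longrightarrow> N \<in> carrier_mat (n * m) (n * m)"
  by (simp add: acts_as_def)

lemma acts_as_mult_mat_vec:
  assumes N: "acts_as n m N f" and x: "x \<in> carrier_vec (n * m)"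
  shows "config_poly n m (N *\<^sub>v x) - f * config_poly n m x \<in> grid_ideal n m 0"
proof -
  have "config_poly n m (N *\<^sub>v x) - f * config_poly n m x
      = (\<Sum>c<n * m. [:[:x $ c:]:] * config_poly n m (col N c)) - (\<Sum>c<n * m. f * ([:[:x $ c:]:] * config_basis m c))"
    unfolding config_poly_mult_mat_vec[OF acts_as_carrier[OF N] x]
    by (simp only: config_poly_def[of n m x] sum_distrib_left)
  also have "\<dots> = (\<Sum>c<n * m. [:[:x $ c:]:] * (config_poly n m (col N c) - f * config_basis m c))"
    unfolding sum_subtractf[symmetric] right_diff_distrib by (simp only: mult.left_commute)
  also have "\<dots> \<in> grid_ideal n m 0"
    using N by (intro ideal.subspace_sum ideal.subspace_scale subspace_grid_ideal) (simp add: acts_as_def)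
  finally show ?thesis .
qed

lemma config_poly_unit_vec:
  assumes "c < n * m"
  shows "config_poly n m (unit_vec (n * m) c :: 'a::comm_ring_1 vec) = config_basis m c"
proof -
  have "config_poly n m (unit_vec (n * m) c :: 'a vec) = (\<Sum>k<n * m. if k = c then config_basis m c else 0)"
    unfolding config_poly_def
  proof (rule sum.cong[OF refl])
    fix k assume "k \<in> {..<n * m}"
    with assms have "(unit_vec (n * m) c :: 'a vec) $ k = (if k = c then 1 else 0)"
      by simp
    then show "[:[:(unit_vec (n * m) c :: 'a vec) $ k:]:] * config_basis m k = (if k = c then config_basis m c else 0)"
      by simp
  qed
  also have "\<dots> = config_basis m c"
    using assms by simp
  finally show ?thesis .
qed

lemma acts_as_one: "acts_as n m (1\<^sub>m (n * m) :: 'a::comm_ring_1 mat) 1"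
  using ideal.subspace_0[OF subspace_grid_ideal, of n m "0 :: 'a poly poly"]
  by (simp add: acts_as_def config_poly_unit_vec)

lemma acts_as_mult:
  assumes N: "acts_as n m N f" and N': "acts_as n m N' g"
  shows "acts_as n m (N * N') (f * g)"
  unfolding acts_as_def
proof (intro conjI allI impI)
  note carrier = acts_as_carrier[OF N] acts_as_carrier[OF N']
  show "N * N' \<in> carrier_mat (n * m) (n * m)"
    using carrier by simp
  fix c assume c: "c < n * m"
  define y where "y = col N' c"
  have y: "y \<in> carrier_vec (n * m)"
    unfolding y_def using carrier by (intro carrier_vecI) simp
  have "config_poly n m (N *\<^sub>v y) - f * config_poly n m y
      + f * (config_poly n m y - g * config_basis m c) \<in> grid_ideal n m 0"
    using N' c y_def acts_as_mult_mat_vec[OF N y]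
    by (intro ideal.subspace_add ideal.subspace_scale subspace_grid_ideal) (auto simp: acts_as_def)
  moreover have "col (N * N') c = N *\<^sub>v y"
    using carrier c unfolding y_def by (intro col_mult2)
  ultimately show "config_poly n m (col (N * N') c) - f * g * config_basis m c \<in> grid_ideal n m 0"
    by (simp only: right_diff_distrib mult.assoc add_diff_eq diff_add_cancel)
qed

lemma acts_as_power:
  assumes "acts_as n m N f"
  shows "acts_as n m (N ^\<^sub>m k) (f ^ k)"
proof (induction k)
  case 0
  show ?case
    using acts_as_one[of n m] acts_as_carrier[OF assms] by simp
next
  case (Suc k)
  show ?case
    using acts_as_mult[OF Suc assms] by (simp add: mult.commute)
qed

lemma bivariate_as_sum:
  fixes U :: "'a::comm_ring_1 poly poly"
  shows "U = (\<Sum>j\<le>degree U. \<Sum>i\<le>degree (coeff U j).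
    [:[:coeff (coeff U j) i:]:] * ([:[:0, 1:]:] ^ i * [:0, 1:] ^ j))"
proof -
  have p: "(\<Sum>i\<le>degree p. [:[:coeff p i:]:] * [:[:0, 1:]:] ^ i) = [:p:]" for p :: "'a poly"
  proof -
    have "[:p:] = [:\<Sum>i\<le>degree p. [:coeff p i:] * [:0, 1:] ^ i:]"
      using poly_as_sum_of_monoms[of p] by (simp add: monom_altdef)
    then show ?thesis
      by (simp only: const_poly.hom_sum const_poly.hom_mult const_poly.hom_power)
  qed
  have "U = (\<Sum>j\<le>degree U. [:coeff U j:] * [:0, 1:] ^ j)"
    using poly_as_sum_of_monoms[of U] by (simp add: monom_altdef)
  also have "\<dots> = (\<Sum>j\<le>degree U. \<Sum>i\<le>degree (coeff U j).
      [:[:coeff (coeff U j) i:]:] * ([:[:0, 1:]:] ^ i * [:0, 1:] ^ j))"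
    by (intro sum.cong refl, subst p[symmetric]) (simp only: sum_distrib_right mult.assoc)
  finally show ?thesis .
qed

lemma acts_as_eval2_mat:
  assumes A: "acts_as n m A [:[:0, 1:]:]" and B: "acts_as n m B [:0, 1:]"
  shows "acts_as n m (eval2_mat U A B) U"
  unfolding acts_as_def
proof (intro conjI allI impI)
  have dim: "dim_row A = n * m" "dim_col A = n * m" "dim_row B = n * m" "dim_col B = n * m"
    using acts_as_carrier[OF A] acts_as_carrier[OF B] by simp_all
  then show "eval2_mat U A B \<in> carrier_mat (n * m) (n * m)"
    by (simp add: eval2_mat_def)
  fix c assume c: "c < n * m"
  let ?u = "\<lambda>i j. [:[:coeff (coeff U j) i:]:]"
  let ?N = "\<lambda>i j. A ^\<^sub>m i * B ^\<^sub>m j"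
  let ?f = "\<lambda>i j. [:[:0, 1:]:] ^ i * [:0, 1:] ^ j"
  have N: "acts_as n m (?N i j) (?f i j)" for i j
    by (intro acts_as_mult acts_as_power A B)
  have "config_poly n m (col (eval2_mat U A B) c)
      = (\<Sum>k<n * m. \<Sum>j\<le>degree U. \<Sum>i\<le>degree (coeff U j). ?u i j * ([:[:col (?N i j) c $ k:]:] * config_basis m k))"
    unfolding config_poly_def
  proof (rule sum.cong[OF refl])
    fix k assume "k \<in> {..<n * m}"
    then have "col (eval2_mat U A B) c $ k
        = (\<Sum>j\<le>degree U. \<Sum>i\<le>degree (coeff U j). coeff (coeff U j) i * col (?N i j) c $ k)"
      using c dim by (simp add: eval2_mat_def)
    then have "[:[:col (eval2_mat U A B) c $ k:]:]
        = (\<Sum>j\<le>degree U. \<Sum>i\<le>degree (coeff U j). ?u i j * [:[:col (?N i j) c $ k:]:])"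
      by (simp only: const_poly.hom_sum const_poly.hom_mult)
    then show "[:[:col (eval2_mat U A B) c $ k:]:] * config_basis m k
        = (\<Sum>j\<le>degree U. \<Sum>i\<le>degree (coeff U j). ?u i j * ([:[:col (?N i j) c $ k:]:] * config_basis m k))"
      by (simp only: sum_distrib_right mult.assoc)
  qed
  also have "\<dots> = (\<Sum>j\<le>degree U. \<Sum>i\<le>degree (coeff U j). \<Sum>k<n * m. ?u i j * ([:[:col (?N i j) c $ k:]:] * config_basis m k))"
    by (rule sum_rotate)
  also have "\<dots> = (\<Sum>j\<le>degree U. \<Sum>i\<le>degree (coeff U j). ?u i j * config_poly n m (col (?N i j) c))"
    by (simp only: config_poly_def sum_distrib_left)
  finally have "config_poly n m (col (eval2_mat U A B) c) - U * config_basis m c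
      = (\<Sum>j\<le>degree U. \<Sum>i\<le>degree (coeff U j). ?u i j * (config_poly n m (col (?N i j) c) - ?f i j * config_basis m c))"
    by (subst bivariate_as_sum[of U])
      (simp only: sum_distrib_right sum_subtractf right_diff_distrib mult.assoc)
  also have "\<dots> \<in> grid_ideal n m 0"
    using N c by (intro ideal.subspace_sum ideal.subspace_scale subspace_grid_ideal) (simp add: acts_as_def)
  finally show "config_poly n m (col (eval2_mat U A B) c) - U * config_basis m c \<in> grid_ideal n m 0" .
qed

section \<open>The matrices A and B as multiplication by X and Y\<close>

lemma J_mat_entry:
  assumes "i < n" "l < n"
  shows "[:[:J_mat n $$ (i, l):]:] * f = (if i = Suc l \<or> l = Suc i then f else 0)"
  using assms by (simp add: J_mat_def)

lemma acts_as_A: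
  assumes m: "m > 0"
  shows "acts_as n m (kronecker (J_mat n) (1\<^sub>m m)) [:[:0, 1:]:]"
  unfolding acts_as_def
proof (intro conjI allI impI)
  show "kronecker (J_mat n) (1\<^sub>m m) \<in> carrier_mat (n * m) (n * m)"
    by (simp add: kronecker_def J_mat_def)
  fix c assume c: "c < n * m"
  define l j' where "l = c div m" and "j' = c mod m"
  have lj: "l < n" "j' < m"
    using c m by (auto simp: l_def j'_def less_mult_imp_div_less)
  let ?x = "[:[:0, 1:]:] :: bit poly poly"
  let ?g = "\<lambda>i j. if j = j' then (if i = Suc l \<or> l = Suc i then Q_seq ?x i else 0) * in_Y (Q_seq [:0, 1:] j') else 0"
  have "config_poly n m (col (kronecker (J_mat n) (1\<^sub>m m)) c) = (\<Sum>k<n * m. ?g (k div m) (k mod m))"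
    unfolding config_poly_def
  proof (rule sum.cong[OF refl])
    fix k assume "k \<in> {..<n * m}"
    then have k: "k < n * m" "k div m < n" "k mod m < m"
      using m by (auto simp: less_mult_imp_div_less)
    have "col (kronecker (J_mat n) (1\<^sub>m m)) c $ k = J_mat n $$ (k div m, l) * (if k mod m = j' then 1 else 0)"
      using k c lj by (simp add: kronecker_def J_mat_def l_def j'_def)
    then have "[:[:col (kronecker (J_mat n) (1\<^sub>m m)) c $ k:]:] * config_basis m k
        = (if k mod m = j' then [:[:J_mat n $$ (k div m, l):]:] * config_basis m k else 0)"
      by (cases "k mod m = j'") (simp_all only: simp_thms if_True if_False mult_1_right mult_zero_right const_poly.hom_zero mult_zero_left)
    also have "\<dots> = ?g (k div m) (k mod m)"
      unfolding J_mat_entry[OF k(2) lj(1)] config_basis_def const_poly.hom_Q_seq by simp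
    finally show "[:[:col (kronecker (J_mat n) (1\<^sub>m m)) c $ k:]:] * config_basis m k = ?g (k div m) (k mod m)" .
  qed
  also have "\<dots> = (\<Sum>i<n. \<Sum>j<m. ?g i j)"
    by (rule sum_div_mod[OF m])
  also have "\<dots> = (\<Sum>i<n. if i = Suc l \<or> l = Suc i then Q_seq ?x i else 0) * in_Y (Q_seq [:0, 1:] j')"
    using lj by (simp add: sum_distrib_right)
  also have "(\<Sum>i<n. if i = Suc l \<or> l = Suc i then Q_seq ?x i else 0)
      = ?x * Q_seq ?x l + (if Suc l = n then Q_seq ?x n else 0)"
    by (rule column_sum_J[OF char2_poly[OF char2_poly]]) (use lj in simp_all)
  finally have "config_poly n m (col (kronecker (J_mat n) (1\<^sub>m m)) c) - ?x * config_basis m c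
      = in_Y (Q_seq [:0, 1:] j') * (if Suc l = n then Q_seq ?x n else 0)"
    unfolding config_basis_def l_def[symmetric] j'_def[symmetric] const_poly.hom_Q_seq
    by (simp only: algebra_simps)
  also have "\<dots> \<in> grid_ideal n m 0"
  proof (intro ideal.subspace_scale subspace_grid_ideal)
    have "Q_seq ?x n \<in> grid_ideal n m 0"
      unfolding grid_ideal_def const_poly.hom_Q_seq[symmetric] by (rule ideal.span_base) simp
    then show "(if Suc l = n then Q_seq ?x n else 0) \<in> grid_ideal n m 0"
      using ideal.subspace_0[OF subspace_grid_ideal] by auto
  qed
  finally show "config_poly n m (col (kronecker (J_mat n) (1\<^sub>m m)) c) - ?x * config_basis m c \<in> grid_ideal n m 0" .
qed

lemma acts_as_B:
  assumes m: "m > 0"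
  shows "acts_as n m (kronecker (1\<^sub>m n) (J_mat m)) [:0, 1:]"
  unfolding acts_as_def
proof (intro conjI allI impI)
  show "kronecker (1\<^sub>m n) (J_mat m) \<in> carrier_mat (n * m) (n * m)"
    by (simp add: kronecker_def J_mat_def)
  fix c assume c: "c < n * m"
  define i' l where "i' = c div m" and "l = c mod m"
  have il: "i' < n" "l < m"
    using c m by (auto simp: l_def i'_def less_mult_imp_div_less)
  let ?y = "[:0, 1:] :: bit poly poly"
  have y: "in_Y (Q_seq [:0, 1:] j) = Q_seq ?y j" for j
    unfolding poly_in_Y.hom_Q_seq poly_in_Y_X ..
  let ?g = "\<lambda>i j. if i = i' then [:Q_seq [:0, 1:] i':] * (if j = Suc l \<or> l = Suc j then Q_seq ?y j else 0) else 0"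
  have "config_poly n m (col (kronecker (1\<^sub>m n) (J_mat m)) c) = (\<Sum>k<n * m. ?g (k div m) (k mod m))"
    unfolding config_poly_def
  proof (rule sum.cong[OF refl])
    fix k assume "k \<in> {..<n * m}"
    then have k: "k < n * m" "k div m < n" "k mod m < m"
      using m by (auto simp: less_mult_imp_div_less)
    have "col (kronecker (1\<^sub>m n) (J_mat m)) c $ k = (if k div m = i' then 1 else 0) * J_mat m $$ (k mod m, l)"
      using k c il by (simp add: kronecker_def J_mat_def l_def i'_def)
    then have "[:[:col (kronecker (1\<^sub>m n) (J_mat m)) c $ k:]:] * config_basis m k
        = (if k div m = i' then [:[:J_mat m $$ (k mod m, l):]:] * config_basis m k else 0)"
      by (cases "k div m = i'") (simp_all only: simp_thms if_True if_False mult_1_left mult_zero_left const_poly.hom_zero)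
    also have "\<dots> = ?g (k div m) (k mod m)"
      unfolding J_mat_entry[OF k(3) il(2)] config_basis_def y by simp
    finally show "[:[:col (kronecker (1\<^sub>m n) (J_mat m)) c $ k:]:] * config_basis m k = ?g (k div m) (k mod m)" .
  qed
  also have "\<dots> = (\<Sum>i<n. \<Sum>j<m. ?g i j)"
    by (rule sum_div_mod[OF m])
  also have "\<dots> = (\<Sum>i<n. if i = i' then [:Q_seq [:0, 1:] i':] * (\<Sum>j<m. if j = Suc l \<or> l = Suc j then Q_seq ?y j else 0) else 0)"
    by (rule sum.cong[OF refl]) (simp add: sum_distrib_left del: mult_pCons_left)
  also have "\<dots> = [:Q_seq [:0, 1:] i':] * (\<Sum>j<m. if j = Suc l \<or> l = Suc j then Q_seq ?y j else 0)"
    using il by simp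
  also have "(\<Sum>j<m. if j = Suc l \<or> l = Suc j then Q_seq ?y j else 0)
      = ?y * Q_seq ?y l + (if Suc l = m then Q_seq ?y m else 0)"
    by (rule column_sum_J[OF char2_poly[OF char2_poly]]) (use il in simp_all)
  finally have "config_poly n m (col (kronecker (1\<^sub>m n) (J_mat m)) c) - ?y * config_basis m c
      = [:Q_seq [:0, 1:] i':] * (if Suc l = m then Q_seq ?y m else 0)"
    unfolding config_basis_def l_def[symmetric] i'_def[symmetric] y
    by (simp only: algebra_simps)
  also have "\<dots> \<in> grid_ideal n m 0"
  proof (intro ideal.subspace_scale subspace_grid_ideal)
    have "Q_seq ?y m \<in> grid_ideal n m 0"
      unfolding grid_ideal_def y[symmetric] by (rule ideal.span_base) simp
    then show "(if Suc l = m then Q_seq ?y m else 0) \<in> grid_ideal n m 0"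
      using ideal.subspace_0[OF subspace_grid_ideal] by auto
  qed
  finally show "config_poly n m (col (kronecker (1\<^sub>m n) (J_mat m)) c) - ?y * config_basis m c \<in> grid_ideal n m 0" .
qed

section \<open>Cyclicity, and the image of M\<close>

lemma config_poly_eq_modulo:
  fixes x y :: "'a::idom vec"
  assumes "n > 0" "m > 0" and x: "x \<in> carrier_vec (n * m)" and y: "y \<in> carrier_vec (n * m)"
    and f: "config_poly n m x - f \<in> grid_ideal n m 0" "config_poly n m y - f \<in> grid_ideal n m 0"
  shows "x = y"
proof -
  have "(config_poly n m x - f) - (config_poly n m y - f) \<in> grid_ideal n m 0"
    by (intro ideal.subspace_diff subspace_grid_ideal f)
  then have "config_poly n m (x - y) \<in> grid_ideal n m 0"
    unfolding config_poly_diff[OF x y] by simp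
  then have "x - y = 0\<^sub>v (n * m)"
    using assms by (intro config_poly_eq_0_modulo) auto
  show "x = y"
  proof (rule eq_vecI)
    fix k assume "k < dim_vec y"
    then have "(x - y) $ k = 0"
      using \<open>x - y = 0\<^sub>v (n * m)\<close> y by simp
    then show "x $ k = y $ k"
      using \<open>k < dim_vec y\<close> x y by simp
  qed (use x y in simp)
qed

text \<open>Index 0 is a corner, whose polynomial is Q_0(X) Q_0(Y) = 1. So every class f comes from
  a configuration, namely f(A, B) applied to the corner.\<close>

lemma eval2_mat_unit_vec_modulo:
  assumes A: "acts_as n m A [:[:0, 1:]:]" and B: "acts_as n m B [:0, 1:]" and nm: "n * m > 0"
  shows "config_poly n m (eval2_mat f A B *\<^sub>v unit_vec (n * m) 0) - f \<in> grid_ideal n m 0"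
  using acts_as_mult_mat_vec[OF acts_as_eval2_mat[OF A B, of f], of "unit_vec (n * m) 0"] nm
  by (simp add: config_poly_unit_vec config_basis_def)

lemma eval2_mat_commute:
  fixes A B M :: "'a::comm_ring_1 mat"
  assumes A: "A \<in> carrier_mat d d" and B: "B \<in> carrier_mat d d" and M: "M \<in> carrier_mat d d"
    and MA: "M * A = A * M" and MB: "M * B = B * M"
  shows "M * eval2_mat f A B = eval2_mat f A B * M"
proof -
  have pow: "M * N ^\<^sub>m i = N ^\<^sub>m i * M" if N: "N \<in> carrier_mat d d" and MN: "M * N = N * M" for N i
  proof (induction i)
    case 0
    then show ?case using M N by simp
  next
    case (Suc i)
    have P: "N ^\<^sub>m i \<in> carrier_mat d d" using N by simp
    have "M * (N ^\<^sub>m i * N) = N ^\<^sub>m i * M * N"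
      using Suc assoc_mult_mat[OF M P N] by simp
    also have "\<dots> = N ^\<^sub>m i * (N * M)"
      using assoc_mult_mat[OF P M N] MN by simp
    also have "\<dots> = N ^\<^sub>m i * N * M"
      using assoc_mult_mat[OF P N M] by simp
    finally show ?case by simp
  qed
  let ?N = "\<lambda>i j. A ^\<^sub>m i * B ^\<^sub>m j"
  have N: "?N i j \<in> carrier_mat d d" for i j
    using A B by (intro mult_carrier_mat[of _ d d]) simp_all
  have MN: "M * ?N i j = ?N i j * M" for i j
  proof -
    have P: "A ^\<^sub>m i \<in> carrier_mat d d" and Q: "B ^\<^sub>m j \<in> carrier_mat d d"
      using A B by simp_all
    have "M * ?N i j = A ^\<^sub>m i * M * B ^\<^sub>m j"
      using pow[OF A MA] assoc_mult_mat[OF M P Q] by simp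
    also have "\<dots> = A ^\<^sub>m i * (B ^\<^sub>m j * M)"
      using pow[OF B MB] assoc_mult_mat[OF P M Q] by simp
    also have "\<dots> = ?N i j * M"
      using assoc_mult_mat[OF P Q M] by simp
    finally show ?thesis .
  qed
  let ?u = "\<lambda>i j. coeff (coeff f j) i"
  show ?thesis
  proof (rule eq_matI)
    fix r c assume "r < dim_row (eval2_mat f A B * M)" "c < dim_col (eval2_mat f A B * M)"
    then have rc: "r < d" "c < d"
      using A M by (simp_all add: eval2_mat_def)
    have "(M * eval2_mat f A B) $$ (r, c)
        = (\<Sum>k<d. M $$ (r, k) * (\<Sum>j\<le>degree f. \<Sum>i\<le>degree (coeff f j). ?u i j * ?N i j $$ (k, c)))"
      using rc A M by (simp add: eval2_mat_def scalar_prod_def lessThan_atLeast0)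
    also have "\<dots> = (\<Sum>j\<le>degree f. \<Sum>i\<le>degree (coeff f j). ?u i j * (\<Sum>k<d. M $$ (r, k) * ?N i j $$ (k, c)))"
      unfolding sum_distrib_left sum_rotate by (intro sum.cong refl mult.left_commute)
    also have "\<dots> = (\<Sum>j\<le>degree f. \<Sum>i\<le>degree (coeff f j). ?u i j * (M * ?N i j) $$ (r, c))"
    proof -
      have "(\<Sum>k<d. M $$ (r, k) * ?N i j $$ (k, c)) = (M * ?N i j) $$ (r, c)" for i j
        using rc M N[of i j] by (simp add: scalar_prod_def lessThan_atLeast0 del: index_mult_mat(2,3))
      then show ?thesis by (simp only:)
    qed
    also have "\<dots> = (\<Sum>j\<le>degree f. \<Sum>i\<le>degree (coeff f j). ?u i j * (\<Sum>k<d. ?N i j $$ (r, k) * M $$ (k, c)))"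
    proof -
      have "(M * ?N i j) $$ (r, c) = (\<Sum>k<d. ?N i j $$ (r, k) * M $$ (k, c))" for i j
        unfolding MN using rc M N[of i j] by (simp add: scalar_prod_def lessThan_atLeast0 del: index_mult_mat(2,3))
      then show ?thesis by (simp only:)
    qed
    also have "\<dots> = (\<Sum>k<d. (\<Sum>j\<le>degree f. \<Sum>i\<le>degree (coeff f j). ?u i j * ?N i j $$ (r, k)) * M $$ (k, c))"
      unfolding sum_distrib_left sum_distrib_right sum_rotate
      by (intro sum.cong refl mult.assoc[symmetric])
    also have "\<dots> = (eval2_mat f A B * M) $$ (r, c)"
      using rc A M by (simp add: eval2_mat_def scalar_prod_def lessThan_atLeast0)
    finally show "(M * eval2_mat f A B) $$ (r, c) = (eval2_mat f A B * M) $$ (r, c)" .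
  qed (use A M in \<open>simp_all add: eval2_mat_def\<close>)
qed

text \<open>The configuration space is a cyclic module, generated by a single lit corner.\<close>

lemma commuting_eq_eval2_mat:
  fixes M A B :: "'a::idom mat"
  assumes n: "n > 0" and m: "m > 0"
    and A: "acts_as n m A [:[:0, 1:]:]" and B: "acts_as n m B [:0, 1:]"
    and M: "M \<in> carrier_mat (n * m) (n * m)" and MA: "M * A = A * M" and MB: "M * B = B * M"
  shows "\<exists>U. M = eval2_mat U A B"
proof
  define e where "e = (unit_vec (n * m) 0 :: 'a vec)"
  define U where "U = config_poly n m (M *\<^sub>v e)"
  have nm: "n * m > 0" using n m by simp
  have e: "e \<in> carrier_vec (n * m)" by (simp add: e_def)
  have E: "acts_as n m (eval2_mat U A B) U"
    by (rule acts_as_eval2_mat[OF A B])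
  have "M *\<^sub>v x = eval2_mat U A B *\<^sub>v x" if x: "x \<in> carrier_vec (n * m)" for x
  proof -
    \<comment> \<open>F = f(A, B) carries e to x. As M commutes with F, M x = F (M e), whose
      polynomial is f U modulo the relations.\<close>
    define f where "f = config_poly n m x"
    define F where "F = eval2_mat f A B"
    have F: "acts_as n m F f"
      unfolding F_def by (rule acts_as_eval2_mat[OF A B])
    note Fc = acts_as_carrier[OF F]
    have "F *\<^sub>v e = x"
    proof (rule config_poly_eq_modulo[OF n m])
      show "config_poly n m (F *\<^sub>v e) - f \<in> grid_ideal n m 0"
        unfolding F_def e_def by (rule eval2_mat_unit_vec_modulo[OF A B nm])
      show "config_poly n m x - f \<in> grid_ideal n m 0"
        using ideal.subspace_0[OF subspace_grid_ideal] by (simp add: f_def)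
    qed (use Fc e x in auto)
    then have "M *\<^sub>v x = (M * F) *\<^sub>v e"
      using assoc_mult_mat_vec[OF M Fc e] by simp
    also have "M * F = F * M"
      unfolding F_def
      by (rule eval2_mat_commute[OF acts_as_carrier[OF A] acts_as_carrier[OF B] M MA MB])
    also have "(F * M) *\<^sub>v e = F *\<^sub>v (M *\<^sub>v e)"
      by (rule assoc_mult_mat_vec[OF Fc M e])
    finally have Mx: "M *\<^sub>v x = F *\<^sub>v (M *\<^sub>v e)" .
    show ?thesis
    proof (rule config_poly_eq_modulo[OF n m])
      have "config_poly n m (M *\<^sub>v x) - f * U \<in> grid_ideal n m 0"
        unfolding Mx U_def by (rule acts_as_mult_mat_vec[OF F]) (use M e in auto)
      then show "config_poly n m (M *\<^sub>v x) - U * f \<in> grid_ideal n m 0"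
        by (simp only: mult.commute)
      show "config_poly n m (eval2_mat U A B *\<^sub>v x) - U * f \<in> grid_ideal n m 0"
        unfolding f_def by (rule acts_as_mult_mat_vec[OF E x])
    qed (use M acts_as_carrier[OF E] x in auto)
  qed
  then have eq: "M *\<^sub>v unit_vec (n * m) c = eval2_mat U A B *\<^sub>v unit_vec (n * m) c" for c
    by simp
  have col: "col N c = N *\<^sub>v unit_vec (n * m) c"
    if "N \<in> carrier_mat (n * m) (n * m)" "c < n * m" for N :: "'a mat" and c
    using col_mult2[OF that(1) one_carrier_mat that(2)] that by simp
  show "M = eval2_mat U A B"
    using M acts_as_carrier[OF E] eq by (intro mat_col_eqI) (simp_all add: col)
qed

text \<open>Applying M multiplies polynomials by U modulo the relations. Conversely, a cofactor g of
  U is realised by the configuration g(A, B) applied to the corner.\<close>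

lemma mem_mat_image_iff:
  fixes M A B :: "'a::idom mat"
  assumes n: "n > 0" and m: "m > 0"
    and A: "acts_as n m A [:[:0, 1:]:]" and B: "acts_as n m B [:0, 1:]"
    and M: "acts_as n m M U" and y: "y \<in> carrier_vec (n * m)"
  shows "y \<in> mat_image M \<longleftrightarrow> config_poly n m y \<in> grid_ideal n m U"
proof
  have Mc: "dim_col M = n * m"
    using acts_as_carrier[OF M] by simp
  show "config_poly n m y \<in> grid_ideal n m U" if "y \<in> mat_image M"
  proof -
    from that obtain x where "x \<in> carrier_vec (n * m)" "y = M *\<^sub>v x"
      by (auto simp: mat_image_def Mc)
    then have "config_poly n m y - config_poly n m x * U \<in> grid_ideal n m 0"
      using acts_as_mult_mat_vec[OF M, of x] by (simp only: mult.commute)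
    then show ?thesis
      using grid_ideal_eq_relations by blast
  qed
  assume "config_poly n m y \<in> grid_ideal n m U"
  then obtain g where g: "config_poly n m y - g * U \<in> grid_ideal n m 0"
    using grid_ideal_eq_relations by blast
  define x where "x = eval2_mat g A B *\<^sub>v unit_vec (n * m) 0"
  have x: "x \<in> carrier_vec (n * m)"
    using acts_as_carrier[OF acts_as_eval2_mat[OF A B, of g]] by (simp add: x_def)
  have xg: "config_poly n m x - g \<in> grid_ideal n m 0"
    unfolding x_def using n m by (intro eval2_mat_unit_vec_modulo A B) simp
  have "M *\<^sub>v x = y"
  proof (rule config_poly_eq_modulo[OF n m _ y _ g])
    have "(config_poly n m (M *\<^sub>v x) - U * config_poly n m x) + U * (config_poly n m x - g)
        \<in> grid_ideal n m 0"
      by (intro ideal.subspace_add ideal.subspace_scale subspace_grid_ideal acts_as_mult_mat_vec[OF M x] xg)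
    also have "(config_poly n m (M *\<^sub>v x) - U * config_poly n m x) + U * (config_poly n m x - g)
        = config_poly n m (M *\<^sub>v x) - g * U"
      by (simp only: algebra_simps)
    finally show "config_poly n m (M *\<^sub>v x) - g * U \<in> grid_ideal n m 0" .
  qed (use acts_as_carrier[OF M] x in auto)
  then show "y \<in> mat_image M"
    using x by (auto simp: mat_image_def Mc)
qed

section \<open>Doubly symmetric configurations as multiples of S_n(X) S_m(Y)\<close>

lemma config_poly_vec_of_config:
  assumes y: "y \<in> carrier_mat n m" and m: "m > 0"
  shows "config_poly n m (vec_of_config y)
    = (\<Sum>i<n. \<Sum>j<m. [:[:y $$ (i, j):]:] * ([:Q_seq [:0, 1:] i:] * in_Y (Q_seq [:0, 1:] j)))"
proof -
  have "config_poly n m (vec_of_config y) = (\<Sum>k<n * m. [:[:y $$ (k div m, k mod m):]:] *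
      ([:Q_seq [:0, 1:] (k div m):] * in_Y (Q_seq [:0, 1:] (k mod m))))"
    unfolding config_poly_def config_basis_def
    using y by (intro sum.cong) (auto simp: vec_of_config_def)
  also have "\<dots> = (\<Sum>i<n. \<Sum>j<m. [:[:y $$ (i, j):]:] * ([:Q_seq [:0, 1:] i:] * in_Y (Q_seq [:0, 1:] j)))"
    by (rule sum_div_mod[OF m])
  finally show ?thesis .
qed

lemma symmetric_gen_eq: "symmetric_gen n m = half_Q [:[:0, 1:]:] n * half_Q [:0, 1:] m"
  unfolding symmetric_gen_def const_poly.hom_half_Q poly_in_Y.hom_half_Q poly_in_Y_X ..

text \<open>Symmetry in i makes each column polynomial G_j divisible by S_n(X); symmetry in j passes
  to the quotients and yields the factor S_m(Y).\<close>

lemma symmetric_gen_dvd_config_poly: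
  fixes y :: "'a::comm_ring_1 mat"
  assumes char2: "(2::'a) = 0" and y: "y \<in> carrier_mat n m" "doubly_symmetric n m y" and m: "m > 0"
  shows "symmetric_gen n m dvd config_poly n m (vec_of_config y)"
proof -
  have c: "(2::'a poly poly) = 0"
    by (intro char2_poly char2)
  let ?x = "[:[:0, 1:]:] :: 'a poly poly" and ?y = "[:0, 1:] :: 'a poly poly"
  define G where "G j = (\<Sum>i<n. [:[:y $$ (i, j):]:] * Q_seq ?x i)" for j
  have dvd: "half_Q ?x n dvd G j" if j: "j < m" for j
    unfolding G_def
  proof (rule half_Q_dvd_symmetric_sum[OF c])
    fix i assume "i < n"
    then have "y $$ (i, j) = y $$ (n - 1 - i, j)"
      using y(2) j unfolding doubly_symmetric_def by blast
    then show "[:[:y $$ (i, j):]:] = [:[:y $$ (n - 1 - i, j):]:]"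
      by (simp only:)
  qed
  \<comment> \<open>The choice depends only on G_j, so equal G_j give equal quotients without
    cancelling S_n(X).\<close>
  define q where "q j = (SOME r. G j = half_Q ?x n * r)" for j
  have q: "G j = half_Q ?x n * q j" if "j < m" for j
    unfolding q_def using dvd[OF that] by (rule someI_ex[OF dvdE]) blast
  have q_sym: "q j = q (m - 1 - j)" if j: "j < m" for j
  proof -
    have "y $$ (i, j) = y $$ (i, m - 1 - j)" if "i < n" for i
      using y(2) that j unfolding doubly_symmetric_def by blast
    then have "G j = G (m - 1 - j)"
      unfolding G_def by (intro sum.cong) auto
    then show ?thesis
      by (simp only: q_def)
  qed
  have "config_poly n m (vec_of_config y) = (\<Sum>i<n. \<Sum>j<m. [:[:y $$ (i, j):]:] * (Q_seq ?x i * Q_seq ?y j))"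
    unfolding config_poly_vec_of_config[OF y(1) m] const_poly.hom_Q_seq poly_in_Y.hom_Q_seq poly_in_Y_X ..
  also have "\<dots> = (\<Sum>j<m. G j * Q_seq ?y j)"
    unfolding G_def by (subst sum.swap) (simp only: sum_distrib_right mult.assoc)
  also have "\<dots> = half_Q ?x n * (\<Sum>j<m. q j * Q_seq ?y j)"
    unfolding sum_distrib_left by (rule sum.cong[OF refl]) (simp only: q lessThan_iff mult.assoc)
  finally show ?thesis
    unfolding symmetric_gen_eq
    by (simp only:) (intro mult_dvd_mono dvd_refl half_Q_dvd_symmetric_sum[OF c] q_sym)
qed

text \<open>The coefficients of S_n in terms of the Q_i: one middle index for odd n, two for even
  n.\<close>

definition central_weight :: "nat \<Rightarrow> nat \<Rightarrow> 'a::comm_ring_1" where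
  "central_weight n i = (if i = n div 2 \<or> even n \<and> Suc i = n div 2 then 1 else 0)"

lemma central_weight_symmetric:
  assumes "i < n"
  shows "central_weight n (n - 1 - i) = central_weight n i"
proof (cases "odd n")
  case True
  then obtain k where "n = 2 * k + 1" by (elim oddE)
  with assms show ?thesis by (auto simp: central_weight_def)
next
  case False
  then obtain k where k: "n = 2 * k" by (auto elim: evenE)
  with assms have "(n - 1 - i = k \<or> Suc (n - 1 - i) = k) = (i = k \<or> Suc i = k)"
    by linarith
  then show ?thesis by (simp add: central_weight_def k)
qed

lemma sum_central_weight:
  assumes "n > 0"
  shows "(\<Sum>i<n. central_weight n i * Q_seq x i) = half_Q x n"
proof (cases "odd n")
  case True
  then have "(\<Sum>i<n. central_weight n i * Q_seq x i) = (\<Sum>i<n. if i = n div 2 then Q_seq x i else 0)"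
    by (intro sum.cong) (auto simp: central_weight_def)
  then show ?thesis
    using True assms by (simp add: half_Q_def)
next
  case False
  then obtain l where l: "n = 2 * l" by (auto elim: evenE)
  with assms obtain k where "l = Suc k" by (cases l) auto
  then have k: "n = 2 * Suc k" by (simp only: l)
  have "(\<Sum>i<n. central_weight n i * Q_seq x i)
      = (\<Sum>i<n. (if i = Suc k then Q_seq x i else 0) + (if i = k then Q_seq x i else 0))"
    by (intro sum.cong) (auto simp: central_weight_def k)
  moreover have "n div 2 = Suc k" "Suc k < n" "k < n"
    using k by auto
  ultimately show ?thesis
    using False unfolding sum.distrib by (simp add: half_Q_def)
qed

text \<open>Lighting the one, two or four central vertices gives exactly S_n(X) S_m(Y).\<close>

lemma symmetric_gen_is_config_poly:
  assumes n: "n > 0" and m: "m > 0"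
  obtains y :: "'a::comm_ring_1 mat" where "y \<in> carrier_mat n m" "doubly_symmetric n m y"
    "config_poly n m (vec_of_config y) = symmetric_gen n m"
proof
  let ?w = "\<lambda>i j. central_weight n i * central_weight m j :: 'a"
  let ?c = "\<lambda>a::'a. [:[:a:]:]"
  let ?x = "[:[:0, 1:]:] :: 'a poly poly" and ?y = "[:0, 1:] :: 'a poly poly"
  define y where "y = mat n m (\<lambda>(i, j). ?w i j)"
  show y: "y \<in> carrier_mat n m" by (simp add: y_def)
  show "doubly_symmetric n m y"
    using central_weight_symmetric[where 'a = 'a, of _ n] central_weight_symmetric[where 'a = 'a, of _ m]
    by (simp add: doubly_symmetric_def y_def)
  have w: "?c (central_weight k i) = central_weight k i" for k i
    by (simp add: central_weight_def)
  have "config_poly n m (vec_of_config y) = (\<Sum>i<n. \<Sum>j<m. ?c (?w i j) * (Q_seq ?x i * Q_seq ?y j))"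
    unfolding config_poly_vec_of_config[OF y m] const_poly.hom_Q_seq poly_in_Y.hom_Q_seq poly_in_Y_X
    by (intro sum.cong) (auto simp: y_def)
  also have "\<dots> = (\<Sum>i<n. \<Sum>j<m. (central_weight n i * Q_seq ?x i) * (central_weight m j * Q_seq ?y j))"
    by (simp only: const_poly.hom_mult w mult_ac)
  also have "\<dots> = half_Q ?x n * half_Q ?y m"
    by (simp only: sum_product[symmetric] sum_central_weight[OF n] sum_central_weight[OF m])
  finally show "config_poly n m (vec_of_config y) = symmetric_gen n m"
    by (simp only: symmetric_gen_eq)
qed

theorem theorem2:
  fixes n m :: nat and M A B :: "bit mat"
  assumes "n \<ge> 1" and "m \<ge> 1"
    and "M \<in> carrier_mat (n * m) (n * m)"
    and "A = kronecker (J_mat n) (1\<^sub>m m)"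
    and "B = kronecker (1\<^sub>m n) (J_mat m)"
    and "M * A = A * M"
    and "M * B = B * M"
  shows "(\<exists>U :: bit poly poly. M = eval2_mat U A B) \<and>
    (\<forall>U :: bit poly poly. M = eval2_mat U A B \<longrightarrow> roots_condition n m U \<longrightarrow>
      ((\<forall>y \<in> carrier_mat n m. doubly_symmetric n m y \<longrightarrow> vec_of_config y \<in> mat_image M) \<longleftrightarrow>
       \<not> (odd n \<and> odd m \<and> eval2 U 0 0 = 0 \<and>
          multiplicity 2 (n + 1) = multiplicity 2 (m + 1))))"
proof (intro conjI allI impI)
  have n: "n > 0" and m: "m > 0"
    using assms by auto
  have A: "acts_as n m A [:[:0, 1:]:]" and B: "acts_as n m B [:0, 1:]"
    using acts_as_A[OF m] acts_as_B[OF m] assms by simp_all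
  show "\<exists>U. M = eval2_mat U A B"
    by (rule commuting_eq_eval2_mat[OF n m A B assms(3,6,7)])
  fix U assume U: "M = eval2_mat U A B" and roots: "roots_condition n m U"
  have M: "acts_as n m M U"
    unfolding U by (rule acts_as_eval2_mat[OF A B])
  have image: "vec_of_config y \<in> mat_image M \<longleftrightarrow> config_poly n m (vec_of_config y) \<in> grid_ideal n m U"
    if "y \<in> carrier_mat n m" for y
    using that by (intro mem_mat_image_iff[OF n m A B M]) (auto simp: vec_of_config_def)
  \<comment> \<open>The generator comes from a doubly symmetric configuration and divides the
    polynomials of all others, so it alone decides whether all are achievable.\<close>
  have "(\<forall>y \<in> carrier_mat n m. doubly_symmetric n m y \<longrightarrow> vec_of_config y \<in> mat_image M)
      \<longleftrightarrow> symmetric_gen n m \<in> grid_ideal n m U"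
  proof (intro iffI ballI impI)
    assume all: "\<forall>y \<in> carrier_mat n m. doubly_symmetric n m y \<longrightarrow> vec_of_config y \<in> mat_image M"
    obtain y :: "bit mat" where y: "y \<in> carrier_mat n m" "doubly_symmetric n m y"
      "config_poly n m (vec_of_config y) = symmetric_gen n m"
      by (rule symmetric_gen_is_config_poly[OF n m])
    then show "symmetric_gen n m \<in> grid_ideal n m U"
      using all image[OF y(1)] by simp
  next
    fix y :: "bit mat"
    assume mem: "symmetric_gen n m \<in> grid_ideal n m U" and y: "y \<in> carrier_mat n m" "doubly_symmetric n m y"
    have "symmetric_gen n m dvd config_poly n m (vec_of_config y)"
      by (rule symmetric_gen_dvd_config_poly[OF _ y m]) simp
    then obtain f where "config_poly n m (vec_of_config y) = f * symmetric_gen n m"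
      by (metis dvdE mult.commute)
    then show "vec_of_config y \<in> mat_image M"
      using ideal.subspace_scale[OF subspace_grid_ideal mem, of f] image[OF y(1)] by simp
  qed
  then show "(\<forall>y \<in> carrier_mat n m. doubly_symmetric n m y \<longrightarrow> vec_of_config y \<in> mat_image M) \<longleftrightarrow>
       \<not> (odd n \<and> odd m \<and> eval2 U 0 0 = 0 \<and> multiplicity 2 (n + 1) = multiplicity 2 (m + 1))"
    unfolding symmetric_gen_mem_iff[OF n m roots] .
qed

end
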